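(* Let $H$ be a Hilbert space and let $X$ be a unital operator space with $X\subseteq C=C^*(X)\subseteq\mathcal B(H)$. If $\mathcal I$ is any maximal boundary subsystem for $X$ in $\mathcal B(H)$, then $\mathcal I\cap C^*(X)$ is the Šilov ideal of $X$ in $C$.
   Context: $X$ is a linear subspace of $\mathcal B(H)$ containing $I_H$, with the inherited matrix norms on $M_\nu(X)\subseteq M_\nu(\mathcal B(H))=\mathcal B(H^\nu)$; $C^*(X)$ is the $C^*$-algebra generated by $X$ in $\mathcal B(H)$. A linear map $\phi$ is completely isometric if all its amplifications $\phi_\nu([a_{ij}])=[\phi(a_{ij})]$, $\nu\in\mathbb N$, are isometric. A boundary subsystem for $X$ in $\mathcal B(H)$ is a selfadjoint linear subspace $\mathcal I\subseteq\mathcal B(H)$ (not required to contain the unit) such that the restriction to $X$ of the quotient map $q_{\mathcal I}\colon\mathcal B(H)\to\mathcal B(H)/\mathcal I$ is completely isometric, where $\mathcal B(H)/\mathcal I$ has matrix norms $\|[a_{ij}+\mathcal I]\|_\nu=\inf\{\|[a_{ij}+y_{ij}]\|_\nu : y_{ij}\in\mathcal I\}$. "Maximal" is with respect to inclusion among boundary subsystems for $X$ in $\mathcal B(H)$. A (closed two-sided) ideal $J$ of $C$ is boundary for $X$ if the quotient map $C\to C/J$ is completely isometric on $X$; the Šilov ideal of $X$ in $C$ is the biggest boundary ideal, i.e. the boundary ideal containing every boundary ideal. *)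

theory Defs
  imports "HOL-Analysis.Analysis"
begin

class complex_vector = real_vector +
  fixes scaleC :: "complex \<Rightarrow> 'a \<Rightarrow> 'a"  (infixr "*\<^sub>C" 75)
  assumes scaleC_add_right: "c *\<^sub>C (x + y) = c *\<^sub>C x + c *\<^sub>C y"
    and scaleC_add_left: "(c + d) *\<^sub>C x = c *\<^sub>C x + d *\<^sub>C x"
    and scaleC_scaleC: "c *\<^sub>C d *\<^sub>C x = (c * d) *\<^sub>C x"
    and scaleC_one: "1 *\<^sub>C x = x"
    and scaleR_scaleC: "r *\<^sub>R x = complex_of_real r *\<^sub>C x"

global_interpretation complex_vector:
  vector_space "scaleC :: complex \<Rightarrow> 'a \<Rightarrow> 'a::complex_vector"
  by standard (simp_all add: scaleC_add_right scaleC_add_left scaleC_scaleC scaleC_one)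

class complex_normed_vector = complex_vector + real_normed_vector +
  assumes norm_scaleC: "norm (c *\<^sub>C x) = cmod c * norm x"

text \<open>The inner product is linear in the first argument.\<close>

class complex_inner = complex_normed_vector +
  fixes cinner :: "'a \<Rightarrow> 'a \<Rightarrow> complex"
  assumes cinner_commute: "cinner x y = cnj (cinner y x)"
    and cinner_add_left: "cinner (x + y) z = cinner x z + cinner y z"
    and cinner_scaleC_left: "cinner (c *\<^sub>C x) y = c * cinner x y"
    and cinner_self: "cinner x x = complex_of_real ((norm x)\<^sup>2)"

class chilbert_space = complex_inner + complete_space

lemma bounded_linear_scaleC_comp:
  fixes f :: "'a::real_normed_vector \<Rightarrow> 'b::complex_normed_vector"
  assumes "bounded_linear f"
  shows "bounded_linear (\<lambda>x. c *\<^sub>C f x)"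
proof -
  interpret f: bounded_linear f by fact
  obtain K where K: "\<And>x. norm (f x) \<le> norm x * K"
    using f.bounded by blast
  show ?thesis
  proof (rule bounded_linear_intro[where K = "cmod c * K"])
    show "c *\<^sub>C f (x + y) = c *\<^sub>C f x + c *\<^sub>C f y" for x y
      by (simp add: f.add scaleC_add_right)
    show "c *\<^sub>C f (r *\<^sub>R x) = r *\<^sub>R c *\<^sub>C f x" for r x
      by (simp add: f.scaleR scaleR_scaleC scaleC_scaleC mult.commute)
    show "norm (c *\<^sub>C f x) \<le> norm x * (cmod c * K)" for x
      using mult_left_mono[OF K[of x], of "cmod c"]
      by (simp add: norm_scaleC mult.left_commute)
  qed
qed

instantiation blinfun :: (real_normed_vector, complex_normed_vector) complex_vector
begin

lift_definition scaleC_blinfun :: "complex \<Rightarrow> 'a \<Rightarrow>\<^sub>L 'b \<Rightarrow> 'a \<Rightarrow>\<^sub>L 'b"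
  is "\<lambda>c f x. c *\<^sub>C f x"
  by (rule bounded_linear_scaleC_comp)

instance
  by standard
    (transfer; simp add: fun_eq_iff scaleC_add_right scaleC_add_left scaleC_scaleC
      scaleC_one scaleR_scaleC)+

end

text \<open>The library type of bounded operators consists of the real-linear ones, so \<open>B(H)\<close> is
  the set of those that are complex-linear; the norm is the operator norm in either case.\<close>

definition BH :: "('a::chilbert_space \<Rightarrow>\<^sub>L 'a) set" where
  "BH = {T. \<forall>c x. blinfun_apply T (c *\<^sub>C x) = c *\<^sub>C blinfun_apply T x}"

definition adj :: "('a::chilbert_space \<Rightarrow>\<^sub>L 'a) \<Rightarrow> ('a \<Rightarrow>\<^sub>L 'a)" where
  "adj T = (THE S. S \<in> BH \<and>
     (\<forall>x y. cinner (blinfun_apply T x) y = cinner x (blinfun_apply S y)))"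

definition cstar_subalgebra :: "('a::chilbert_space \<Rightarrow>\<^sub>L 'a) set \<Rightarrow> bool" where
  "cstar_subalgebra A \<longleftrightarrow>
     A \<subseteq> BH \<and> complex_vector.subspace A \<and> closed A \<and>
     (\<forall>S\<in>A. \<forall>T\<in>A. S o\<^sub>L T \<in> A) \<and> (\<forall>T\<in>A. adj T \<in> A)"

definition cstar_generated :: "('a::chilbert_space \<Rightarrow>\<^sub>L 'a) set \<Rightarrow> ('a \<Rightarrow>\<^sub>L 'a) set" where
  "cstar_generated X = \<Inter>{A. cstar_subalgebra A \<and> X \<subseteq> A}"

definition unital_operator_space :: "('a::chilbert_space \<Rightarrow>\<^sub>L 'a) set \<Rightarrow> bool" where
  "unital_operator_space X \<longleftrightarrow> X \<subseteq> BH \<and> complex_vector.subspace X \<and> id_blinfun \<in> X"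

text \<open>An \<open>n \<times> n\<close> matrix is a function of two indices of which only the values at indices
  below \<open>n\<close> matter; likewise for vectors in \<open>H\<^sup>n\<close>.  The norm below is the operator norm on \<open>H\<^sup>n\<close>,
  written with quotients as in \<open>onorm\<close>, where \<open>0 / 0 = 0\<close>.\<close>

definition mat_norm :: "nat \<Rightarrow> (nat \<Rightarrow> nat \<Rightarrow> 'a::chilbert_space \<Rightarrow>\<^sub>L 'a) \<Rightarrow> real" where
  "mat_norm n a =
     (SUP \<xi>. L2_set (\<lambda>i. norm (\<Sum>j<n. blinfun_apply (a i j) (\<xi> j))) {..<n}
            / L2_set (\<lambda>i. norm (\<xi> i)) {..<n})"

definition quot_map :: "('a::chilbert_space \<Rightarrow>\<^sub>L 'a) set \<Rightarrow> ('a \<Rightarrow>\<^sub>L 'a) \<Rightarrow> ('a \<Rightarrow>\<^sub>L 'a) set" where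
  "quot_map I a = {a + y | y. y \<in> I}"

text \<open>The norm of a matrix of cosets: the infimum of the norms of all matrices of
  representatives.\<close>

definition quot_mat_norm :: "nat \<Rightarrow> (nat \<Rightarrow> nat \<Rightarrow> ('a::chilbert_space \<Rightarrow>\<^sub>L 'a) set) \<Rightarrow> real" where
  "quot_mat_norm n A = Inf {mat_norm n b | b. \<forall>i<n. \<forall>j<n. b i j \<in> A i j}"

definition completely_isometric_on ::
    "(nat \<Rightarrow> (nat \<Rightarrow> nat \<Rightarrow> 'x) \<Rightarrow> real) \<Rightarrow> (nat \<Rightarrow> (nat \<Rightarrow> nat \<Rightarrow> 'y) \<Rightarrow> real)
      \<Rightarrow> 'x set \<Rightarrow> ('x \<Rightarrow> 'y) \<Rightarrow> bool" where
  "completely_isometric_on N N' X \<phi> \<longleftrightarrow>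
     (\<forall>n a. (\<forall>i<n. \<forall>j<n. a i j \<in> X) \<longrightarrow> N' n (\<lambda>i j. \<phi> (a i j)) = N n a)"

definition boundary_subsystem ::
    "('a::chilbert_space \<Rightarrow>\<^sub>L 'a) set \<Rightarrow> ('a \<Rightarrow>\<^sub>L 'a) set \<Rightarrow> bool" where
  "boundary_subsystem X I \<longleftrightarrow>
     I \<subseteq> BH \<and> complex_vector.subspace I \<and> (\<forall>T\<in>I. adj T \<in> I) \<and>
     completely_isometric_on mat_norm quot_mat_norm X (quot_map I)"

definition maximal_boundary_subsystem ::
    "('a::chilbert_space \<Rightarrow>\<^sub>L 'a) set \<Rightarrow> ('a \<Rightarrow>\<^sub>L 'a) set \<Rightarrow> bool" where
  "maximal_boundary_subsystem X I \<longleftrightarrow>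
     boundary_subsystem X I \<and> (\<forall>I'. boundary_subsystem X I' \<and> I \<subseteq> I' \<longrightarrow> I' = I)"

definition closed_ideal :: "('a::chilbert_space \<Rightarrow>\<^sub>L 'a) set \<Rightarrow> ('a \<Rightarrow>\<^sub>L 'a) set \<Rightarrow> bool" where
  "closed_ideal C J \<longleftrightarrow>
     J \<subseteq> C \<and> complex_vector.subspace J \<and> closed J \<and>
     (\<forall>c\<in>C. \<forall>y\<in>J. c o\<^sub>L y \<in> J \<and> y o\<^sub>L c \<in> J)"

text \<open>The matrix norms of the \<open>C\<^sup>*\<close>-algebra \<open>C/J\<close> are the quotient norms, because
  \<open>M\<^sub>n(C/J) = M\<^sub>n(C)/M\<^sub>n(J)\<close> isometrically.\<close>

definition boundary_ideal ::
    "('a::chilbert_space \<Rightarrow>\<^sub>L 'a) set \<Rightarrow> ('a \<Rightarrow>\<^sub>L 'a) set \<Rightarrow> ('a \<Rightarrow>\<^sub>L 'a) set \<Rightarrow> bool" where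
  "boundary_ideal X C J \<longleftrightarrow>
     closed_ideal C J \<and> completely_isometric_on mat_norm quot_mat_norm X (quot_map J)"

definition is_shilov_ideal ::
    "('a::chilbert_space \<Rightarrow>\<^sub>L 'a) set \<Rightarrow> ('a \<Rightarrow>\<^sub>L 'a) set \<Rightarrow> ('a \<Rightarrow>\<^sub>L 'a) set \<Rightarrow> bool" where
  "is_shilov_ideal X C J \<longleftrightarrow>
     boundary_ideal X C J \<and> (\<forall>J'. boundary_ideal X C J' \<longrightarrow> J' \<subseteq> J)"

end

theory Submission
  imports Defs
begin

text \<open>
  The idea is to turn the maximal boundary subsystem \<open>I\<close> into the kernel of a unital completely
  positive projection \<open>\<phi>\<close> of \<open>B(H)\<close> that fixes \<open>X\<close>, and to use the Choi--Effros multiplication on the range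
  of \<open>\<phi>\<close>.

  Norm conditions are replaced by order conditions: \<open>X \<rightarrow> B(H)/I\<close> is completely isometric iff every
  matrix \<open>x\<close> over \<open>X\<close> is accretive as soon as \<open>x + y\<close> is accretive for some matrix \<open>y\<close> over \<open>I\<close>
  (\<open>completely_isometric_iff_accretive_boundary\<close>). Arveson's extension theorem, proved here from a
  Hahn--Banach theorem for function spaces, then extends \<open>x + y \<mapsto> x\<close> to a unital completely positive
  map \<open>\<phi>\<close> that fixes \<open>X\<close> and kills \<open>I\<close> (\<open>ucp_extension\<close>). Its kernel is a boundary subsystem, so it is \<open>I\<close> by
  maximality. The space of all \<open>a - \<phi>(a)\<close> is also a boundary subsystem, by a telescoping argument
  with the iterates of \<open>\<phi>\<close>, and it contains \<open>I\<close>; so \<open>\<phi>\<close> is idempotent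
  (\<open>maximal_boundary_ucp\<close>). By the Schwarz inequality the kernel of an idempotent \<open>\<phi>\<close> is a module over
  the range, in particular over \<open>X\<close> and \<open>X\<^sup>*\<close> (\<open>ucp_kernel_module\<close>). Hence \<open>C I \<subseteq> I\<close> and \<open>I C \<subseteq> I\<close> for
  \<open>C = C\<^sup>*(X)\<close>, so that \<open>I \<inter> C\<close> is an ideal of \<open>C\<close>; it is boundary because \<open>I\<close> is.

  If \<open>J\<close> is another boundary ideal, the same extension theorem gives a map \<open>\<psi>\<close> that fixes \<open>X\<close> and kills \<open>J\<close>.
  Maximality of \<open>I\<close> forces \<open>\<phi> \<psi> \<phi> = \<phi>\<close>, so \<open>\<phi> \<psi>\<close> is a projection onto the range of \<open>\<phi>\<close>. The
  Choi--Effros product depends on the range only (\<open>ucp_product_unique\<close>), and both projections fix \<open>X\<close>;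
  so they agree on \<open>C\<close> (\<open>ucp_agree_on_generated\<close>). As \<open>\<phi> \<psi>\<close> kills \<open>J\<close>, so does \<open>\<phi>\<close>, which means \<open>J \<subseteq> I\<close>.
\<close>

section \<open>Operators on a complex Hilbert space\<close>

lemma cinner_add_right: "cinner x (y + z) = cinner x y + cinner x (z::'a::complex_inner)"
  by (metis cinner_add_left cinner_commute complex_cnj_add)

lemma cinner_scaleC_right: "cinner x (c *\<^sub>C y) = cnj c * cinner x (y::'a::complex_inner)"
  by (metis cinner_commute cinner_scaleC_left complex_cnj_mult)

lemma cinner_zero_left [simp]: "cinner 0 (y::'a::complex_inner) = 0"
  using cinner_add_left[of 0 0 y] by simp

lemma cinner_zero_right [simp]: "cinner (x::'a::complex_inner) 0 = 0"
  using cinner_add_right[of x 0 0] by simp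

lemma cinner_minus_left: "cinner (- x) (y::'a::complex_inner) = - cinner x y"
  using cinner_add_left[of "- x" x y] by (simp add: eq_neg_iff_add_eq_0)

lemma cinner_minus_right: "cinner (x::'a::complex_inner) (- y) = - cinner x y"
  using cinner_add_right[of x "- y" y] by (simp add: eq_neg_iff_add_eq_0)

lemma cinner_diff_left: "cinner (x - y) (z::'a::complex_inner) = cinner x z - cinner y z"
  using cinner_add_left[of x "- y" z] by (simp add: cinner_minus_left)

lemma cinner_diff_right: "cinner (x::'a::complex_inner) (y - z) = cinner x y - cinner x z"
  using cinner_add_right[of x y "- z"] by (simp add: cinner_minus_right)

lemma cinner_scaleR_left: "cinner (r *\<^sub>R x) (y::'a::complex_inner) = of_real r * cinner x y"
  by (simp add: scaleR_scaleC cinner_scaleC_left)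

lemma cinner_scaleR_right: "cinner x (r *\<^sub>R (y::'a::complex_inner)) = of_real r * cinner x y"
  by (simp add: scaleR_scaleC cinner_scaleC_right)

lemma cinner_sum_left: "cinner (sum f A) (y::'a::complex_inner) = (\<Sum>i\<in>A. cinner (f i) y)"
  by (induction A rule: infinite_finite_induct) (auto simp: cinner_add_left)

lemma cinner_sum_right: "cinner (y::'a::complex_inner) (sum f A) = (\<Sum>i\<in>A. cinner y (f i))"
  by (induction A rule: infinite_finite_induct) (auto simp: cinner_add_right)

lemmas cinner_linear =
  cinner_add_left cinner_add_right cinner_diff_left cinner_diff_right cinner_minus_left
  cinner_minus_right cinner_scaleC_left cinner_scaleC_right cinner_scaleR_left cinner_scaleR_right

lemma Re_cinner_commute: "Re (cinner y x) = Re (cinner x (y::'a::complex_inner))"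
  by (subst cinner_commute) simp

lemma norm_cinner_self: "cmod (cinner x x) = norm x * norm (x::'a::complex_inner)"
  unfolding cinner_self norm_of_real by (simp add: power2_eq_square)

lemma norm_add_square:
  "(norm (x + y))\<^sup>2 = (norm x)\<^sup>2 + 2 * Re (cinner x y) + (norm (y::'a::complex_inner))\<^sup>2"
proof -
  have "complex_of_real ((norm (x + y))\<^sup>2) = cinner (x + y) (x + y)"
    by (simp add: cinner_self)
  also have "Re \<dots> = Re (cinner x x) + 2 * Re (cinner x y) + Re (cinner y y)"
    by (simp add: cinner_linear Re_cinner_commute[of y x])
  finally show ?thesis by (simp add: cinner_self)
qed

lemma norm_diff_square:
  "(norm (x - y))\<^sup>2 = (norm x)\<^sup>2 - 2 * Re (cinner x y) + (norm (y::'a::complex_inner))\<^sup>2"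
  using norm_add_square[of x "- y"] by (simp add: cinner_minus_right)

lemma Re_cinner_le: "Re (cinner x y) \<le> norm x * norm (y::'a::complex_inner)"
proof -
  have "(norm (x + y))\<^sup>2 \<le> (norm x + norm y)\<^sup>2"
    by (intro power_mono norm_triangle_ineq norm_ge_zero)
  then show ?thesis by (simp add: norm_add_square power2_sum)
qed

lemma ex_unimodular_Re: "\<exists>c. cmod c = 1 \<and> Re (c * z) = cmod z"
proof (cases "z = 0")
  case False
  then show ?thesis
    by (intro exI[of _ "cnj z / cmod z"])
      (simp add: norm_divide complex_norm_square[symmetric] mult.commute[of "cnj z"] power2_eq_square
        del: complex_mult_cnj)
qed (auto intro: exI[of _ 1])

lemma norm_cinner_le: "cmod (cinner x y) \<le> norm x * norm (y::'a::complex_inner)"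
proof -
  obtain c where c: "cmod c = 1" "Re (c * cinner x y) = cmod (cinner x y)"
    using ex_unimodular_Re by blast
  then have "cmod (cinner x y) = Re (cinner (c *\<^sub>C x) y)" by (simp add: cinner_scaleC_left)
  also have "\<dots> \<le> norm (c *\<^sub>C x) * norm y" by (rule Re_cinner_le)
  finally show ?thesis using c by (simp add: norm_scaleC)
qed

lemma cinner_eqI: "(\<And>y. cinner x y = cinner x' y) \<Longrightarrow> x = (x'::'a::complex_inner)"
proof -
  assume "\<And>y. cinner x y = cinner x' y"
  then have "cinner (x - x') (x - x') = 0" by (simp add: cinner_diff_left)
  then show "x = x'" by (simp add: cinner_self)
qed

lemma cinner_eqI_right: "(\<And>y. cinner y x = cinner y x') \<Longrightarrow> x = (x'::'a::complex_inner)"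
  by (rule cinner_eqI) (metis cinner_commute)

text \<open>The representing vector is the minimiser of \<open>\<parallel>x\<parallel>\<^sup>2 - 2 Re f(x)\<close>: by the parallelogram law every
  minimising sequence is Cauchy, and at its limit the first variation of this functional vanishes.\<close>

lemma riesz_representation:
  fixes f :: "'a::chilbert_space \<Rightarrow> complex"
  assumes add: "\<And>x y. f (x + y) = f x + f y"
    and scale: "\<And>c x. f (c *\<^sub>C x) = c * f x"
    and bound: "\<And>x. cmod (f x) \<le> K * norm x"
  shows "\<exists>z. \<forall>x. f x = cinner x z"
proof -
  define J where "J x = (norm x)\<^sup>2 - 2 * Re (f x)" for x
  have scaleR: "f (r *\<^sub>R x) = of_real r * f x" for r x by (simp add: scaleR_scaleC scale)
  have bl: "bounded_linear f"
    by (rule bounded_linear_intro[where K = K])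
      (auto simp: add scaleR scaleR_conv_of_real bound mult.commute[of _ K])
  have below: "- K\<^sup>2 \<le> J x" for x
  proof -
    have "Re (f x) \<le> K * norm x" using complex_Re_le_cmod[of "f x"] bound[of x] by linarith
    moreover have "0 \<le> (norm x - K)\<^sup>2" by simp
    ultimately show ?thesis unfolding J_def by (simp add: power2_diff algebra_simps)
  qed
  define m where "m = Inf (range J)"
  have bdd: "bdd_below (range J)" using below by (auto intro!: bdd_belowI)
  have m_le: "m \<le> J x" for x unfolding m_def by (rule cInf_lower[OF _ bdd]) auto
  have "\<exists>x. J x < m + 1 / real (Suc n)" for n
  proof -
    have "\<exists>r\<in>range J. r < m + 1 / real (Suc n)"
      unfolding m_def by (rule cInf_lessD) auto
    then show ?thesis by auto
  qed
  then obtain s where s: "\<And>n. J (s n) < m + 1 / real (Suc n)" by metis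
  have par: "(norm (x - y))\<^sup>2 = 2 * J x + 2 * J y - 4 * J ((1/2) *\<^sub>R (x + y))" for x y
  proof -
    have "(norm ((1/2) *\<^sub>R (x + y)))\<^sup>2 = (norm (x + y))\<^sup>2 / 4" by (simp add: power_divide)
    then show ?thesis unfolding J_def
      by (simp add: norm_add_square norm_diff_square scaleR add algebra_simps)
  qed
  have close: "(norm (s i - s j))\<^sup>2 < 4 / real (Suc N)" if "N \<le> i" "N \<le> j" for i j N
  proof -
    have "1 / real (Suc i) \<le> 1 / real (Suc N)" "1 / real (Suc j) \<le> 1 / real (Suc N)"
      using that by (auto intro!: divide_left_mono)
    then have "J (s i) < m + 1 / real (Suc N)" "J (s j) < m + 1 / real (Suc N)"
      using s[of i] s[of j] by linarith+
    moreover have "m \<le> J ((1/2) *\<^sub>R (s i + s j))" by (rule m_le)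
    ultimately show ?thesis unfolding par by simp
  qed
  have "Cauchy s"
  proof (rule metric_CauchyI)
    fix e :: real assume "0 < e"
    then obtain N where N: "4 / e\<^sup>2 < real (Suc N)"
      using reals_Archimedean2[of "4 / e\<^sup>2"] by (metis less_Suc_eq of_nat_less_iff less_trans lessI)
    then have N': "4 / real (Suc N) < e\<^sup>2"
      using \<open>0 < e\<close> by (simp add: field_simps)
    show "\<exists>M. \<forall>i\<ge>M. \<forall>j\<ge>M. dist (s i) (s j) < e"
    proof (intro exI allI impI)
      fix i j assume "N \<le> i" "N \<le> j"
      then have "(norm (s i - s j))\<^sup>2 < e\<^sup>2" using close N' by fastforce
      then show "dist (s i) (s j) < e"
        using \<open>0 < e\<close> by (simp add: dist_norm power_less_imp_less_base)
    qed
  qed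
  then obtain z where z: "s \<longlonglongrightarrow> z" using Cauchy_convergent convergent_def by blast
  have "(\<lambda>n. J (s n)) \<longlonglongrightarrow> J z"
    unfolding J_def by (intro tendsto_intros z bounded_linear.tendsto[OF bl])
  moreover have "(\<lambda>n. m + 1 / real (Suc n)) \<longlonglongrightarrow> m + 0"
    by (intro tendsto_intros LIMSEQ_Suc[OF lim_1_over_n])
  ultimately have "J z \<le> m + 0"
    using s by (intro LIMSEQ_le[of "\<lambda>n. J (s n)"]) (auto intro!: less_imp_le)
  then have Jz: "J z \<le> J x" for x using m_le[of x] by simp
  \<comment> \<open>minimality of \<open>J\<close> along the line \<open>z + t h\<close>\<close>
  have ReF: "Re (cinner h z) = Re (f h)" for h
  proof -
    define d where "d = Re (cinner z h) - Re (f h)"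
    have quad: "0 \<le> 2 * t * d + t\<^sup>2 * (norm h)\<^sup>2" for t
      using Jz[of "z + t *\<^sub>R h"] unfolding J_def d_def
      by (simp add: norm_add_square add scaleR cinner_scaleR_right power_mult_distrib algebra_simps)
    define N where "N = (norm h)\<^sup>2"
    define u where "u = d / (N + 1)"
    have N: "0 \<le> N" by (simp add: N_def)
    then have d: "d = u * (N + 1)" by (simp add: u_def)
    have "0 \<le> - (u\<^sup>2 * (N + 2))"
      using quad[of "- u"] unfolding N_def[symmetric] d by (simp add: algebra_simps power2_eq_square)
    moreover have "0 \<le> u\<^sup>2 * (N + 2)" using N by simp
    ultimately have "u\<^sup>2 * (N + 2) = 0" by linarith
    then have "d = 0" using N d by auto
    then show ?thesis by (simp add: d_def Re_cinner_commute)
  qed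
  have "f h = cinner h z" for h
  proof (rule complex_eqI)
    show "Im (f h) = Im (cinner h z)"
      using ReF[of "\<i> *\<^sub>C h"] by (simp add: scale cinner_scaleC_left)
  qed (simp add: ReF)
  then show ?thesis by blast
qed

lemma blinfun_apply_scaleC [simp]: "blinfun_apply (c *\<^sub>C T) x = c *\<^sub>C blinfun_apply T x"
  by (simp add: scaleC_blinfun.rep_eq)

lemma BH_scaleC: "T \<in> BH \<Longrightarrow> blinfun_apply T (c *\<^sub>C x) = c *\<^sub>C blinfun_apply T x"
  by (simp add: BH_def)

text \<open>Two constructions rest on this: the adjoint below, and the values of the extensions to \<open>B(H)\<close>,
  which are first obtained as forms.\<close>

lemma sesquilinear_form_operator:
  fixes f :: "'a::chilbert_space \<Rightarrow> 'a \<Rightarrow> complex"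
  assumes addl: "\<And>x x' y. f (x + x') y = f x y + f x' y"
    and scalel: "\<And>c x y. f (c *\<^sub>C x) y = c * f x y"
    and addr: "\<And>x y y'. f x (y + y') = f x y + f x y'"
    and scaler: "\<And>c x y. f x (c *\<^sub>C y) = cnj c * f x y"
    and bound: "\<And>x y. cmod (f x y) \<le> K * norm x * norm y"
  shows "\<exists>T\<in>BH. \<forall>x y. cinner (blinfun_apply T x) y = f x y"
proof -
  have "\<exists>z. \<forall>y. cnj (f x y) = cinner y z" for x
    by (rule riesz_representation[where K = "K * norm x"]) (simp_all add: addr scaler bound)
  then obtain t where "\<And>x y. cnj (f x y) = cinner y (t x)" by metis
  then have t: "cinner (t x) y = f x y" for x y by (metis cinner_commute complex_cnj_cnj)
  have "bounded_linear t"
  proof (rule bounded_linear_intro[where K = K])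
    show "t (x + y) = t x + t y" for x y
      by (rule cinner_eqI) (simp add: t cinner_linear addl)
    show "t (r *\<^sub>R x) = r *\<^sub>R t x" for r x
      by (rule cinner_eqI) (simp add: t cinner_linear scalel scaleR_scaleC)
    show "norm (t x) \<le> norm x * K" for x
    proof (cases "t x = 0")
      case True
      have "0 \<le> norm x * K"
      proof (cases "x = 0")
        case False
        have "0 \<le> K * norm x * norm x" using bound[of x x] norm_ge_zero order_trans by blast
        with False show ?thesis by (simp add: zero_le_mult_iff mult.commute)
      qed simp
      with True show ?thesis by simp
    next
      case False
      have "norm (t x) * norm (t x) = cmod (f x (t x))"
        unfolding t[symmetric] by (rule norm_cinner_self[symmetric])
      also have "\<dots> \<le> (norm x * K) * norm (t x)" using bound[of x "t x"] by (simp add: mult.commute)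
      finally show ?thesis using False by simp
    qed
  qed
  then have ap: "blinfun_apply (Blinfun t) = t" by (rule bounded_linear_Blinfun_apply)
  have "Blinfun t \<in> BH"
    unfolding BH_def ap mem_Collect_eq
    by (intro allI, rule cinner_eqI) (simp only: t scalel cinner_scaleC_left)
  then show ?thesis by (rule bexI[rotated]) (simp add: ap t)
qed

lemma adj_unique:
  assumes "\<And>x y. cinner (blinfun_apply T x) y = cinner x (blinfun_apply S y)"
    and "\<And>x y. cinner (blinfun_apply T x) y = cinner x (blinfun_apply S' y)"
  shows "S = (S'::'a::chilbert_space \<Rightarrow>\<^sub>L 'a)"
  by (rule blinfun_eqI, rule cinner_eqI_right) (metis assms)

lemma
  assumes "T \<in> BH"
  shows adj_in_BH: "adj T \<in> BH"
    and cinner_adj: "cinner (blinfun_apply T x) y = cinner x (blinfun_apply (adj T) y)"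
proof -
  have "\<exists>S\<in>BH. \<forall>x y. cinner (blinfun_apply S x) y = cnj (cinner (blinfun_apply T y) x)"
  proof (rule sesquilinear_form_operator[where K = "norm T"])
    show "cmod (cnj (cinner (blinfun_apply T y) x)) \<le> norm T * norm x * norm y" for x y
    proof -
      have "cmod (cinner (blinfun_apply T y) x) \<le> norm (blinfun_apply T y) * norm x"
        by (rule norm_cinner_le)
      also have "\<dots> \<le> norm T * norm y * norm x" by (intro mult_right_mono norm_blinfun) auto
      finally show ?thesis by (simp add: mult_ac)
    qed
  qed (simp_all add: cinner_linear blinfun.add_right BH_scaleC[OF assms])
  then obtain S where S: "S \<in> BH" "\<And>x y. cinner (blinfun_apply T x) y = cinner x (blinfun_apply S y)"
    by (metis cinner_commute complex_cnj_cnj)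
  have "adj T \<in> BH \<and>
      (\<forall>x y. cinner (blinfun_apply T x) y = cinner x (blinfun_apply (adj T) y))"
    unfolding adj_def
  proof (rule theI)
    show "S \<in> BH \<and> (\<forall>x y. cinner (blinfun_apply T x) y = cinner x (blinfun_apply S y))"
      using S by blast
  next
    fix S' assume "S' \<in> BH \<and> (\<forall>x y. cinner (blinfun_apply T x) y = cinner x (blinfun_apply S' y))"
    then show "S' = S" using S adj_unique by blast
  qed
  then show "adj T \<in> BH"
    and "cinner (blinfun_apply T x) y = cinner x (blinfun_apply (adj T) y)" by blast+
qed

lemma cinner_adj_left:
  "T \<in> BH \<Longrightarrow> cinner (blinfun_apply (adj T) x) y = cinner x (blinfun_apply T y)"
  by (metis cinner_adj cinner_commute)

lemma adj_eqI:
  assumes "T \<in> BH" "\<And>x y. cinner (blinfun_apply T x) y = cinner x (blinfun_apply S y)"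
  shows "adj T = S"
  using cinner_adj[OF assms(1)] assms(2) by (rule adj_unique)

lemma subspace_BH: "complex_vector.subspace (BH :: ('a::chilbert_space \<Rightarrow>\<^sub>L 'a) set)"
  by (rule complex_vector.subspaceI)
    (auto simp: BH_def blinfun.add_left scaleC_add_right scaleC_scaleC mult.commute)

lemmas BH_add = complex_vector.subspace_add[OF subspace_BH]
  and BH_diff = complex_vector.subspace_diff[OF subspace_BH]
  and BH_scale = complex_vector.subspace_scale[OF subspace_BH]
  and BH_zero = complex_vector.subspace_0[OF subspace_BH]

lemma BH_id: "id_blinfun \<in> BH" by (simp add: BH_def)

lemma BH_compose: "S \<in> BH \<Longrightarrow> T \<in> BH \<Longrightarrow> S o\<^sub>L T \<in> BH" by (simp add: BH_def)

lemma norm_scaleC_blinfun_le: "norm (c *\<^sub>C T) \<le> cmod c * norm (T::'a::chilbert_space \<Rightarrow>\<^sub>L 'a)"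
  by (rule norm_blinfun_bound)
    (auto simp: norm_scaleC mult.assoc intro: mult_left_mono norm_blinfun)

lemma bounded_linear_scaleC_right:
  "bounded_linear ((*\<^sub>C) c :: 'a \<Rightarrow> 'a::complex_normed_vector)"
  using bounded_linear_scaleC_comp[OF bounded_linear_ident, of c] by simp

lemma closed_BH: "closed (BH :: ('a::chilbert_space \<Rightarrow>\<^sub>L 'a) set)"
proof -
  have "BH = (\<Inter>c x. {T::'a \<Rightarrow>\<^sub>L 'a. blinfun_apply T (c *\<^sub>C x) = c *\<^sub>C blinfun_apply T x})"
    by (auto simp: BH_def)
  moreover have "closed {T::'a \<Rightarrow>\<^sub>L 'a. blinfun_apply T (c *\<^sub>C x) = c *\<^sub>C blinfun_apply T x}" for c x
    by (intro closed_Collect_eq continuous_intros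
        bounded_linear.continuous_on[OF bounded_linear_scaleC_right])
  ultimately show ?thesis by (metis (no_types, lifting) closed_INT)
qed

lemma adj_add: "S \<in> BH \<Longrightarrow> T \<in> BH \<Longrightarrow> adj (S + T) = adj S + adj T"
  by (rule adj_eqI) (auto simp: BH_add blinfun.add_left cinner_linear cinner_adj)

lemma adj_scaleC: "T \<in> BH \<Longrightarrow> adj (c *\<^sub>C T) = cnj c *\<^sub>C adj T"
  by (rule adj_eqI) (auto simp: BH_scale cinner_linear cinner_adj)

lemma adj_diff: "S \<in> BH \<Longrightarrow> T \<in> BH \<Longrightarrow> adj (S - T) = adj S - adj T"
  by (rule adj_eqI) (auto simp: BH_diff blinfun.diff_left cinner_linear cinner_adj)

lemma adj_adj: "T \<in> BH \<Longrightarrow> adj (adj T) = T"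
  by (rule adj_eqI) (auto simp: adj_in_BH cinner_adj_left)

lemma adj_compose: "S \<in> BH \<Longrightarrow> T \<in> BH \<Longrightarrow> adj (S o\<^sub>L T) = adj T o\<^sub>L adj S"
  by (rule adj_eqI) (auto simp: BH_compose cinner_adj)

lemma adj_zero [simp]: "adj 0 = 0"
  by (rule adj_eqI) (auto simp: BH_zero)

lemma norm_adj_le:
  assumes "T \<in> BH" shows "norm (adj T) \<le> norm T"
proof (rule norm_blinfun_bound)
  fix x
  let ?y = "blinfun_apply (adj T) x"
  show "norm ?y \<le> norm T * norm x"
  proof (cases "?y = 0")
    case False
    have "norm ?y * norm ?y = cmod (cinner ?y ?y)"
      by (rule norm_cinner_self[symmetric])
    also have "\<dots> = cmod (cinner x (blinfun_apply T ?y))" by (simp add: cinner_adj_left assms)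
    also have "\<dots> \<le> norm x * (norm T * norm ?y)"
      by (intro order_trans[OF norm_cinner_le] mult_left_mono norm_blinfun norm_ge_zero)
    finally show ?thesis using False by (simp add: mult.assoc[symmetric] mult.commute[of "norm x"])
  qed simp
qed simp

text \<open>Over the complex scalars the form \<open>\<langle>T x, y\<rangle>\<close> is recovered from its diagonal by polarisation with
  \<open>x + y\<close> and \<open>x + \<i> y\<close>.\<close>

lemma BH_eq_0I:
  assumes T: "T \<in> BH" and q: "\<And>x. cinner (blinfun_apply T x) x = 0"
  shows "T = 0"
proof -
  have "cinner (blinfun_apply T x) y = 0" for x y
  proof -
    define a b where "a = cinner (blinfun_apply T x) y" and "b = cinner (blinfun_apply T y) x"
    have "a + b = 0"
      using q[of "x + y"] by (simp add: blinfun.add_right cinner_linear q a_def b_def add.commute)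
    moreover have "a - b = 0"
      using q[of "x + \<i> *\<^sub>C y"]
      by (simp add: blinfun.add_right cinner_linear q BH_scaleC[OF T] a_def b_def algebra_simps)
    ultimately show "a = 0" by simp
  qed
  then show ?thesis by (intro blinfun_eqI cinner_eqI) simp
qed

section \<open>Extension of positive functionals\<close>

text \<open>A minimal sublinear functional is linear. If \<open>q\<close> is minimal and \<open>a\<close> is a vector, then
  \<open>g \<mapsto> inf (q (g + t a) - t q a)\<close>, with the infimum over \<open>t \<ge> 0\<close>, is sublinear and lies below \<open>q\<close>, so
  it equals \<open>q\<close>, and \<open>t = 1\<close> yields superadditivity. Zorn's lemma provides a minimal \<open>q\<close> below \<open>p\<close>. This is the
  Hahn--Banach theorem in the form that is needed here, for spaces of real functions.\<close>

lemma linear_below_sublinear: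
  fixes D :: "('z \<Rightarrow> real) set" and p :: "('z \<Rightarrow> real) \<Rightarrow> real"
  assumes Dne: "D \<noteq> {}"
    and Dadd: "\<And>g h. g \<in> D \<Longrightarrow> h \<in> D \<Longrightarrow> (\<lambda>z. g z + h z) \<in> D"
    and Dscale: "\<And>g c. g \<in> D \<Longrightarrow> (\<lambda>z. c * g z) \<in> D"
    and padd: "\<And>g h. g \<in> D \<Longrightarrow> h \<in> D \<Longrightarrow> p (\<lambda>z. g z + h z) \<le> p g + p h"
    and pscale: "\<And>g c. g \<in> D \<Longrightarrow> 0 < c \<Longrightarrow> p (\<lambda>z. c * g z) = c * p g"
  obtains F where
    "\<And>g h. g \<in> D \<Longrightarrow> h \<in> D \<Longrightarrow> F (\<lambda>z. g z + h z) = F g + F h"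
    "\<And>g c. g \<in> D \<Longrightarrow> F (\<lambda>z. c * g z) = c * F g"
    "\<And>g. g \<in> D \<Longrightarrow> F g \<le> p g"
proof -
  have D0: "(\<lambda>z. 0) \<in> D" using Dne Dscale[of _ 0] by auto
  have Dminus: "(\<lambda>z. - g z) \<in> D" if "g \<in> D" for g using Dscale[OF that, of "- 1"] by simp
  \<comment> \<open>The value \<open>0\<close> off \<open>D\<close> makes the pointwise order antisymmetric.\<close>
  define S where "S = {q :: ('z \<Rightarrow> real) \<Rightarrow> real. (\<forall>g. g \<notin> D \<longrightarrow> q g = 0) \<and>
    (\<forall>g\<in>D. \<forall>h\<in>D. q (\<lambda>z. g z + h z) \<le> q g + q h) \<and>
    (\<forall>g\<in>D. \<forall>c>0. q (\<lambda>z. c * g z) = c * q g) \<and> (\<forall>g\<in>D. q g \<le> p g)}"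
  have SI: "q \<in> S" if "\<And>g. g \<notin> D \<Longrightarrow> q g = 0"
    "\<And>g h. g \<in> D \<Longrightarrow> h \<in> D \<Longrightarrow> q (\<lambda>z. g z + h z) \<le> q g + q h"
    "\<And>g c. g \<in> D \<Longrightarrow> 0 < c \<Longrightarrow> q (\<lambda>z. c * g z) \<le> c * q g" "\<And>g. g \<in> D \<Longrightarrow> q g \<le> p g" for q
  proof -
    have "c * q g \<le> q (\<lambda>z. c * g z)" if "g \<in> D" "0 < c" for g c
      using \<open>\<And>g c. g \<in> D \<Longrightarrow> 0 < c \<Longrightarrow> q (\<lambda>z. c * g z) \<le> c * q g\<close>[OF Dscale[OF that(1)], of "1 / c" c] that(2)
      by (simp add: field_simps)
    with that show ?thesis unfolding S_def by (auto intro: antisym)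
  qed
  have qout: "q g = 0" if "q \<in> S" "g \<notin> D" for q g using that unfolding S_def by blast
  have qadd: "q (\<lambda>z. g z + h z) \<le> q g + q h" if "q \<in> S" "g \<in> D" "h \<in> D" for q g h
    using that unfolding S_def by blast
  have qscale: "q (\<lambda>z. c * g z) = c * q g" if "q \<in> S" "g \<in> D" "0 < c" for q g c
    using that unfolding S_def by blast
  have qp: "q g \<le> p g" if "q \<in> S" "g \<in> D" for q g using that unfolding S_def by blast
  have q0: "q (\<lambda>z. 0) = 0" if "q \<in> S" for q using qscale[OF that D0, of 2] by simp
  have qlow: "- p (\<lambda>z. - g z) \<le> q g" if "q \<in> S" "g \<in> D" for q g
    using qadd[OF that(1) that(2) Dminus[OF that(2)]] q0[OF that(1)]
      qp[OF that(1) Dminus[OF that(2)]] by simp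
  define R where "R q q' \<longleftrightarrow> (\<forall>g. q' g \<le> q g)" for q q' :: "('z \<Rightarrow> real) \<Rightarrow> real"
  have po: "partial_order_on S (relation_of R S)"
    by (rule partial_order_on_relation_ofI)
      (auto simp: R_def fun_eq_iff intro: order_trans antisym)
  have p_in: "(\<lambda>g. if g \<in> D then p g else 0) \<in> S"
    by (rule SI) (auto simp: Dadd Dscale padd pscale)
  have "\<exists>u\<in>S. \<forall>q\<in>C. R q u" if C: "C \<in> Chains (relation_of R S)" for C
  proof (cases "C = {}")
    case True
    then show ?thesis using p_in by auto
  next
    case False
    have CS: "C \<subseteq> S" and tot: "\<And>q q'. q \<in> C \<Longrightarrow> q' \<in> C \<Longrightarrow> R q q' \<or> R q' q"
      using C unfolding Chains_def relation_of_def by auto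
    define u where "u g = (if g \<in> D then INF q\<in>C. q g else 0)" for g
    have bdd: "bdd_below ((\<lambda>q. q g) ` C)" if "g \<in> D" for g
      using qlow[OF _ that] CS by (intro bdd_belowI[of _ "- p (\<lambda>z. - g z)"]) auto
    have ule: "u g \<le> q g" if "q \<in> C" for g q
      using that qout[of q g] CS by (cases "g \<in> D") (auto simp: u_def subset_iff intro!: cINF_lower bdd)
    have uge: "b \<le> u g" if "g \<in> D" "\<And>q. q \<in> C \<Longrightarrow> b \<le> q g" for b g
      using that False by (auto simp: u_def intro!: cINF_greatest)
    have "u \<in> S"
    proof (rule SI)
      fix g h assume gh: "g \<in> D" "h \<in> D"
      have "u (\<lambda>z. g z + h z) \<le> q g + q' h" if q: "q \<in> C" "q' \<in> C" for q q'
      proof -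
        obtain q'' where q'': "q'' \<in> C" "R q q''" "R q' q''"
          using tot[OF q] q unfolding R_def by blast
        have "u (\<lambda>z. g z + h z) \<le> q'' (\<lambda>z. g z + h z)" by (rule ule) fact
        also have "\<dots> \<le> q'' g + q'' h" using q'' CS gh by (auto intro: qadd)
        also have "\<dots> \<le> q g + q' h" using q'' by (auto simp: R_def intro: add_mono)
        finally show ?thesis .
      qed
      then have "u (\<lambda>z. g z + h z) - q g \<le> u h" if "q \<in> C" for q
        using that gh by (intro uge) (simp_all add: diff_le_eq add.commute[of _ "q g"])
      then have "u (\<lambda>z. g z + h z) - u h \<le> u g"
        using gh by (intro uge) (simp_all add: diff_le_eq add.commute)
      then show "u (\<lambda>z. g z + h z) \<le> u g + u h" by simp
    next
      fix g and c :: real assume g: "g \<in> D" "0 < c"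
      have "u (\<lambda>z. c * g z) / c \<le> q g" if "q \<in> C" for q
        using ule[OF that, of "\<lambda>z. c * g z"] qscale[of q g c] that CS g by (auto simp: field_simps)
      then have "u (\<lambda>z. c * g z) / c \<le> u g" using g by (intro uge) auto
      then show "u (\<lambda>z. c * g z) \<le> c * u g" using g by (simp add: field_simps)
    next
      fix g assume "g \<in> D"
      obtain q where "q \<in> C" using False by auto
      then show "u g \<le> p g" using ule[of q g] qp[of q g] CS \<open>g \<in> D\<close> by force
    qed (simp add: u_def)
    then show ?thesis using ule by (auto simp: R_def)
  qed
  with predicate_Zorn[OF po] obtain q where q: "q \<in> S" and min: "\<And>q'. q' \<in> S \<Longrightarrow> R q q' \<Longrightarrow> q = q'"
    by blast
  have qq: "q g + q a \<le> q (\<lambda>z. g z + a z)" if g: "g \<in> D" and a: "a \<in> D" for g a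
  proof -
    define k where "k g t = q (\<lambda>z. g z + t * a z) - t * q a" for g and t :: real
    define u where "u g = (if g \<in> D then INF t\<in>{0..}. k g t else 0)" for g
    have Dk: "(\<lambda>z. g z + t * a z) \<in> D" if "g \<in> D" for g t using that a by (intro Dadd Dscale)
    have low: "- q (\<lambda>z. - g z) \<le> k g t" if "g \<in> D" "0 \<le> t" for g t
    proof -
      have "t * q a = q (\<lambda>z. t * a z)"
        using qscale[OF q a, of t] q0[OF q] that by (cases "t = 0") auto
      then show ?thesis
        using qadd[OF q Dk[OF that(1), of t] Dminus[OF that(1)]] by (simp add: k_def)
    qed
    have bdd: "bdd_below (k g ` {0..})" if "g \<in> D" for g
      using low[OF that] by (intro bdd_belowI[of _ "- q (\<lambda>z. - g z)"]) auto
    have ule: "u g \<le> k g t" if "g \<in> D" "0 \<le> t" for g t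
      using that by (auto simp: u_def intro!: cINF_lower bdd)
    have uge: "b \<le> u g" if "g \<in> D" "\<And>t. 0 \<le> t \<Longrightarrow> b \<le> k g t" for b g
      using that by (auto simp: u_def intro!: cINF_greatest)
    have uq: "u g \<le> q g" for g
      using ule[of g 0] qout[OF q, of g] by (cases "g \<in> D") (auto simp: k_def u_def)
    have "u \<in> S"
    proof (rule SI)
      fix g h assume gh: "g \<in> D" "h \<in> D"
      have "u (\<lambda>z. g z + h z) \<le> k g s + k h t" if "0 \<le> s" "0 \<le> t" for s t
      proof -
        have "u (\<lambda>z. g z + h z) \<le> k (\<lambda>z. g z + h z) (s + t)" using that gh Dadd by (intro ule) auto
        also have "\<dots> \<le> k g s + k h t"
          using qadd[OF q Dk[OF gh(1), of s] Dk[OF gh(2), of t]] by (simp add: k_def algebra_simps)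
        finally show ?thesis .
      qed
      then have "u (\<lambda>z. g z + h z) - k g s \<le> u h" if "0 \<le> s" for s
        using that gh by (intro uge) (simp_all add: diff_le_eq add.commute[of _ "k g s"])
      then have "u (\<lambda>z. g z + h z) - u h \<le> u g"
        using gh by (intro uge) (simp_all add: diff_le_eq add.commute)
      then show "u (\<lambda>z. g z + h z) \<le> u g + u h" by simp
    next
      fix g and c :: real assume g: "g \<in> D" "0 < c"
      have "u (\<lambda>z. c * g z) / c \<le> k g t" if "0 \<le> t" for t
      proof -
        have "u (\<lambda>z. c * g z) \<le> k (\<lambda>z. c * g z) (c * t)" using that g Dscale by (intro ule) auto
        also have "\<dots> = c * k g t"
          using qscale[OF q Dk[OF g(1), of t] g(2)] by (simp add: k_def algebra_simps)
        finally show ?thesis using g by (simp add: field_simps)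
      qed
      then have "u (\<lambda>z. c * g z) / c \<le> u g" using g by (intro uge) auto
      then show "u (\<lambda>z. c * g z) \<le> c * u g" using g by (simp add: field_simps)
    next
      fix g assume "g \<in> D"
      then show "u g \<le> p g" using uq[of g] qp[OF q, of g] by simp
    qed (simp add: u_def)
    then have "q = u" using uq by (intro min) (auto simp: R_def)
    then show ?thesis using ule[OF g, of 1] by (simp add: k_def)
  qed
  have Fadd: "q (\<lambda>z. g z + h z) = q g + q h" if "g \<in> D" "h \<in> D" for g h
    using qq[OF that] qadd[OF q that] by simp
  have Fminus: "q (\<lambda>z. - g z) = - q g" if "g \<in> D" for g
    using Fadd[OF that Dminus[OF that]] q0[OF q] by simp
  have "q (\<lambda>z. c * g z) = c * q g" if g: "g \<in> D" for c g
  proof (cases c "0::real" rule: linorder_cases)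
    case less
    then show ?thesis
      using Fminus[OF Dscale[OF g, of "- c"]] qscale[OF q g, of "- c"] by simp
  qed (use qscale[OF q g] q0[OF q] in auto)
  then show thesis using Fadd qp[OF q] by (intro that[of q])
qed

definition majorised :: "(('z \<Rightarrow> real) \<times> real) set \<Rightarrow> ('z \<Rightarrow> real) set" where
  "majorised M = {g. \<exists>u r. (u, r) \<in> M \<and> (\<forall>z. \<bar>g z\<bar> \<le> u z)}"

lemma majorised_add:
  assumes M: "\<And>u r v s. (u, r) \<in> M \<Longrightarrow> (v, s) \<in> M \<Longrightarrow> (\<lambda>z. u z + v z, r + s) \<in> M"
    and "g \<in> majorised M" "h \<in> majorised M"
  shows "(\<lambda>z. g z + h z) \<in> majorised M"
proof -
  obtain u r where u: "(u, r) \<in> M" "\<And>z. \<bar>g z\<bar> \<le> u z"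
    using assms(2) unfolding majorised_def by blast
  obtain v s where v: "(v, s) \<in> M" "\<And>z. \<bar>h z\<bar> \<le> v z"
    using assms(3) unfolding majorised_def by blast
  have "\<bar>g z + h z\<bar> \<le> u z + v z" for z
    using abs_triangle_ineq[of "g z" "h z"] u(2)[of z] v(2)[of z] by linarith
  then show ?thesis unfolding majorised_def using M[OF u(1) v(1)] by blast
qed

lemma majorised_scale:
  assumes M: "\<And>u r c. (u, r) \<in> M \<Longrightarrow> (\<lambda>z. c * u z, c * r) \<in> M" and "g \<in> majorised M"
  shows "(\<lambda>z. c * g z) \<in> majorised M"
proof -
  obtain u r where u: "(u, r) \<in> M" "\<And>z. \<bar>g z\<bar> \<le> u z"
    using assms(2) unfolding majorised_def by blast
  then have "\<bar>c * g z\<bar> \<le> \<bar>c\<bar> * u z" for z by (simp add: abs_mult mult_left_mono)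
  then show ?thesis unfolding majorised_def using M[OF u(1), of "\<bar>c\<bar>"] by blast
qed

text \<open>Kantorovich's extension theorem for positive functionals: the functional
  \<open>p(g) = inf {r | (u, r) \<in> M, g \<le> u}\<close> is sublinear, and every linear functional below it is positive and
  extends the given one. The latter is given by its graph \<open>M\<close> because then it need not be known in advance
  that \<open>u\<close> determines \<open>r\<close>; positivity implies it.\<close>

lemma positive_extension:
  fixes M :: "(('z \<Rightarrow> real) \<times> real) set"
  assumes M0: "(\<lambda>z. 0, 0) \<in> M"
    and Madd: "\<And>u r v s. (u, r) \<in> M \<Longrightarrow> (v, s) \<in> M \<Longrightarrow> (\<lambda>z. u z + v z, r + s) \<in> M"
    and Mscale: "\<And>u r c. (u, r) \<in> M \<Longrightarrow> (\<lambda>z. c * u z, c * r) \<in> M"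
    and Mpos: "\<And>u r. (u, r) \<in> M \<Longrightarrow> (\<And>z. 0 \<le> u z) \<Longrightarrow> 0 \<le> r"
  obtains F where
    "\<And>g h. g \<in> majorised M \<Longrightarrow> h \<in> majorised M \<Longrightarrow> F (\<lambda>z. g z + h z) = F g + F h"
    "\<And>g c. g \<in> majorised M \<Longrightarrow> F (\<lambda>z. c * g z) = c * F g"
    "\<And>g. g \<in> majorised M \<Longrightarrow> (\<And>z. 0 \<le> g z) \<Longrightarrow> 0 \<le> F g"
    "\<And>u r. (u, r) \<in> M \<Longrightarrow> u \<in> majorised M \<Longrightarrow> F u = r"
proof -
  let ?D = "majorised M"
  have D0: "(\<lambda>z. 0) \<in> ?D" unfolding majorised_def using M0 by auto
  have Dadd: "(\<lambda>z. g z + h z) \<in> ?D" if "g \<in> ?D" "h \<in> ?D" for g h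
    using Madd that by (rule majorised_add)
  have Dscale: "(\<lambda>z. c * g z) \<in> ?D" if "g \<in> ?D" for g c
    using Mscale that by (rule majorised_scale)
  define P where "P g = {r. \<exists>u. (u, r) \<in> M \<and> (\<forall>z. g z \<le> u z)}" for g
  define p where "p g = Inf (P g)" for g
  have Pne: "P g \<noteq> {}" if g: "g \<in> ?D" for g
  proof -
    obtain u r where u: "(u, r) \<in> M" "\<And>z. \<bar>g z\<bar> \<le> u z"
      using g unfolding majorised_def by blast
    then have "r \<in> P g" unfolding P_def using abs_le_D1 by blast
    then show ?thesis by blast
  qed
  have bdd: "bdd_below (P g)" if g: "g \<in> ?D" for g
  proof -
    obtain v s where v: "(v, s) \<in> M" "\<And>z. \<bar>g z\<bar> \<le> v z"
      using g unfolding majorised_def by blast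
    have "- s \<le> r" if "r \<in> P g" for r
    proof -
      obtain u where u: "(u, r) \<in> M" "\<And>z. g z \<le> u z" using \<open>r \<in> P g\<close> unfolding P_def by blast
      have "0 \<le> u z + v z" for z using u(2)[of z] v(2)[of z] by linarith
      then show ?thesis using Mpos[OF Madd[OF u(1) v(1)]] by simp
    qed
    then show ?thesis by (rule bdd_belowI)
  qed
  have ple: "p g \<le> r" if "g \<in> ?D" "r \<in> P g" for g r
    unfolding p_def using that bdd by (intro cInf_lower)
  have pge: "b \<le> p g" if "g \<in> ?D" "\<And>r. r \<in> P g \<Longrightarrow> b \<le> r" for b g
    unfolding p_def using that Pne by (intro cInf_greatest) auto
  have padd: "p (\<lambda>z. g z + h z) \<le> p g + p h" if gh: "g \<in> ?D" "h \<in> ?D" for g h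
  proof -
    have "p (\<lambda>z. g z + h z) \<le> r + s" if "r \<in> P g" "s \<in> P h" for r s
    proof (rule ple[OF Dadd[OF gh]])
      obtain u where u: "(u, r) \<in> M" "\<And>z. g z \<le> u z"
        using \<open>r \<in> P g\<close> unfolding P_def by blast
      obtain v where v: "(v, s) \<in> M" "\<And>z. h z \<le> v z"
        using \<open>s \<in> P h\<close> unfolding P_def by blast
      show "r + s \<in> P (\<lambda>z. g z + h z)"
        unfolding P_def using Madd[OF u(1) v(1)] u(2) v(2)
        by (auto intro!: exI[of _ "\<lambda>z. u z + v z"] add_mono)
    qed
    then have "p (\<lambda>z. g z + h z) - r \<le> p h" if "r \<in> P g" for r
      using that gh by (intro pge) (simp_all add: diff_le_eq add.commute[of _ r])
    then have "p (\<lambda>z. g z + h z) - p h \<le> p g"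
      using gh by (intro pge) (simp_all add: diff_le_eq add.commute)
    then show ?thesis by simp
  qed
  have pscale_le: "p (\<lambda>z. c * g z) \<le> c * p g" if g: "g \<in> ?D" "0 < c" for g c
  proof -
    have "p (\<lambda>z. c * g z) / c \<le> r" if "r \<in> P g" for r
    proof -
      obtain u where "(u, r) \<in> M" "\<And>z. g z \<le> u z" using \<open>r \<in> P g\<close> unfolding P_def by blast
      then have "c * r \<in> P (\<lambda>z. c * g z)"
        unfolding P_def using Mscale[of u r c] g by (auto intro!: exI[of _ "\<lambda>z. c * u z"])
      then show ?thesis using ple[OF Dscale[OF g(1)]] g by (fastforce simp: field_simps)
    qed
    then have "p (\<lambda>z. c * g z) / c \<le> p g" using g by (intro pge)
    then show ?thesis using g by (simp add: field_simps)
  qed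
  have pscale: "p (\<lambda>z. c * g z) = c * p g" if g: "g \<in> ?D" "0 < c" for g c
    using pscale_le[OF g] pscale_le[OF Dscale[OF g(1), of c], of "1 / c"] g(2)
    by (simp add: field_simps)
  obtain F where F: "\<And>g h. g \<in> ?D \<Longrightarrow> h \<in> ?D \<Longrightarrow> F (\<lambda>z. g z + h z) = F g + F h"
    "\<And>g c. g \<in> ?D \<Longrightarrow> F (\<lambda>z. c * g z) = c * F g" "\<And>g. g \<in> ?D \<Longrightarrow> F g \<le> p g"
    using linear_below_sublinear[of ?D p] D0 Dadd Dscale padd pscale by blast
  show thesis
  proof (rule that[OF F(1,2)])
    fix g assume g: "g \<in> ?D" "\<And>z. 0 \<le> g z"
    have "p (\<lambda>z. (- 1) * g z) \<le> 0"
      using M0 g by (intro ple Dscale) (auto simp: P_def)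
    then show "0 \<le> F g" using F(3)[OF Dscale[OF g(1), of "- 1"]] F(2)[OF g(1), of "- 1"] by simp
  next
    fix u r assume u: "(u, r) \<in> M" "u \<in> ?D"
    have "F v \<le> s" if "(v, s) \<in> M" "v \<in> ?D" for v s
    proof -
      have "s \<in> P v" using that(1) unfolding P_def by blast
      then show ?thesis using F(3)[OF that(2)] ple[OF that(2)] by fastforce
    qed
    from this[OF u] this[OF Mscale[OF u(1)] Dscale[OF u(2)], of "- 1"]
    show "F u = r" using F(2)[OF u(2), of "- 1"] by simp
  qed auto
qed

section \<open>Accretive matrices and matrix norms\<close>

definition quad :: "'i set \<Rightarrow> ('i \<Rightarrow> 'i \<Rightarrow> 'a::chilbert_space \<Rightarrow>\<^sub>L 'a) \<Rightarrow> ('i \<Rightarrow> 'a) \<Rightarrow> real" where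
  "quad A v \<zeta> = Re (\<Sum>i\<in>A. \<Sum>j\<in>A. cinner (blinfun_apply (v i j) (\<zeta> j)) (\<zeta> i))"

text \<open>An operator matrix is accretive if its real part is a positive operator on the direct sum of
  copies of \<open>H\<close>. Accretivity is used instead of positivity because it makes sense for matrices that
  are not selfadjoint, and so for matrices over \<open>X\<close>. Index sets of arbitrary type are allowed, since block matrices and
  matrices indexed by vectors of \<open>H\<close> occur below.\<close>

definition accretive :: "'i set \<Rightarrow> ('i \<Rightarrow> 'i \<Rightarrow> 'a::chilbert_space \<Rightarrow>\<^sub>L 'a) \<Rightarrow> bool" where
  "accretive A v \<longleftrightarrow> (\<forall>\<zeta>. 0 \<le> quad A v \<zeta>)"

lemma quad_add: "quad A (\<lambda>i j. v i j + w i j) \<zeta> = quad A v \<zeta> + quad A w \<zeta>"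
  by (simp add: quad_def blinfun.add_left cinner_linear sum.distrib)

lemma quad_cong: "(\<And>i j. i \<in> A \<Longrightarrow> j \<in> A \<Longrightarrow> v i j = w i j) \<Longrightarrow> quad A v \<zeta> = quad A w \<zeta>"
  unfolding quad_def by (intro arg_cong[of _ _ Re] sum.cong refl) simp

lemma accretive_cong:
  "(\<And>i j. i \<in> A \<Longrightarrow> j \<in> A \<Longrightarrow> v i j = w i j) \<Longrightarrow> accretive A v \<longleftrightarrow> accretive A w"
  unfolding accretive_def by (simp add: quad_cong[of A v w])

lemma quad_reindex:
  "bij_betw h B A \<Longrightarrow> quad A v \<zeta> = quad B (\<lambda>i j. v (h i) (h j)) (\<zeta> \<circ> h)"
  by (simp add: quad_def sum.reindex_bij_betw[of h B A, symmetric])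

lemma accretive_reindex:
  assumes "bij_betw h B A"
  shows "accretive A v \<longleftrightarrow> accretive B (\<lambda>i j. v (h i) (h j))"
proof
  assume L: "accretive A v"
  show "accretive B (\<lambda>i j. v (h i) (h j))"
    unfolding accretive_def
  proof
    fix \<zeta>
    have "quad B (\<lambda>i j. v (h i) (h j)) \<zeta> = quad B (\<lambda>i j. v (h i) (h j)) ((\<zeta> \<circ> inv_into B h) \<circ> h)"
      unfolding quad_def using assms
      by (intro arg_cong[of _ _ Re] sum.cong refl) (simp add: bij_betw_def)
    then show "0 \<le> quad B (\<lambda>i j. v (h i) (h j)) \<zeta>"
      using L by (simp add: quad_reindex[OF assms, symmetric] accretive_def)
  qed
qed (simp add: accretive_def quad_reindex[OF assms])

text \<open>The order-theoretic form of the condition that \<open>X \<rightarrow> B(H)/I\<close> is completely isometric: the map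
  \<open>x + y \<mapsto> x\<close> on \<open>X + I\<close> takes accretive matrices to accretive matrices. The equivalence is
  \<open>completely_isometric_iff_accretive_boundary\<close>.\<close>

definition accretive_boundary ::
    "('a::chilbert_space \<Rightarrow>\<^sub>L 'a) set \<Rightarrow> ('a \<Rightarrow>\<^sub>L 'a) set \<Rightarrow> bool" where
  "accretive_boundary X I \<longleftrightarrow> (\<forall>n x y. (\<forall>i<n. \<forall>j<n. x i j \<in> X \<and> y i j \<in> I) \<longrightarrow>
     accretive {..<n::nat} (\<lambda>i j. x i j + y i j) \<longrightarrow> accretive {..<n} x)"

lemma accretive_boundaryD:
  assumes I: "accretive_boundary X I" and A: "finite A"
    and x: "\<And>i j. i \<in> A \<Longrightarrow> j \<in> A \<Longrightarrow> x i j \<in> X"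
    and y: "\<And>i j. i \<in> A \<Longrightarrow> j \<in> A \<Longrightarrow> y i j \<in> I"
    and acc: "accretive A (\<lambda>i j. x i j + y i j)"
  shows "accretive A x"
proof -
  obtain h where h: "bij_betw h {0..<card A} A" using ex_bij_betw_nat_finite[OF A] by blast
  then have "h i \<in> A" if "i < card A" for i using that by (auto simp: bij_betw_def)
  moreover have "bij_betw h {..<card A} A" using h by (simp add: atLeast0LessThan)
  ultimately show ?thesis
    using I[unfolded accretive_boundary_def, rule_format,
        of "card A" "\<lambda>i j. x (h i) (h j)" "\<lambda>i j. y (h i) (h j)"] acc x y
    by (simp add: accretive_reindex)
qed

definition mat_apply :: "nat \<Rightarrow> (nat \<Rightarrow> nat \<Rightarrow> 'a::chilbert_space \<Rightarrow>\<^sub>L 'a) \<Rightarrow> (nat \<Rightarrow> 'a) \<Rightarrow> nat \<Rightarrow> 'a"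
  where "mat_apply n a \<xi> i = (\<Sum>j<n. blinfun_apply (a i j) (\<xi> j))"

definition vec_norm :: "nat \<Rightarrow> (nat \<Rightarrow> 'a::chilbert_space) \<Rightarrow> real" where
  "vec_norm n \<xi> = L2_set (\<lambda>i. norm (\<xi> i)) {..<n}"

lemma vec_norm_nonneg [simp]: "0 \<le> vec_norm n \<xi>" by (simp add: vec_norm_def)

lemma vec_norm_square: "(vec_norm n \<xi>)\<^sup>2 = (\<Sum>i<n. (norm (\<xi> i))\<^sup>2)"
  by (simp add: vec_norm_def L2_set_def sum_nonneg)

lemma mat_norm_altdef: "mat_norm n a = (SUP \<xi>. vec_norm n (mat_apply n a \<xi>) / vec_norm n \<xi>)"
  by (simp add: mat_norm_def vec_norm_def mat_apply_def)

lemma quad_altdef: "quad {..<n} v \<zeta> = (\<Sum>i<n. Re (cinner (mat_apply n v \<zeta> i) (\<zeta> i)))"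
  by (simp add: quad_def mat_apply_def cinner_sum_left)

lemma norm_le_vec_norm: "j < n \<Longrightarrow> norm (\<xi> j) \<le> vec_norm n \<xi>"
  unfolding vec_norm_def by (rule member_le_L2_set) auto

lemma mat_apply_bounded: "\<exists>K\<ge>0. \<forall>\<xi>. vec_norm n (mat_apply n a \<xi>) \<le> K * vec_norm n \<xi>"
proof (intro exI conjI allI)
  show "0 \<le> (\<Sum>i<n. \<Sum>j<n. norm (a i j))" by (intro sum_nonneg norm_ge_zero)
  fix \<xi>
  have "vec_norm n (mat_apply n a \<xi>) \<le> (\<Sum>i<n. norm (mat_apply n a \<xi> i))"
    unfolding vec_norm_def by (rule L2_set_le_sum) simp
  also have "\<dots> \<le> (\<Sum>i<n. \<Sum>j<n. norm (a i j) * vec_norm n \<xi>)"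
  proof (rule sum_mono)
    fix i
    have "norm (mat_apply n a \<xi> i) \<le> (\<Sum>j<n. norm (blinfun_apply (a i j) (\<xi> j)))"
      unfolding mat_apply_def by (rule norm_sum)
    also have "\<dots> \<le> (\<Sum>j<n. norm (a i j) * vec_norm n \<xi>)"
      by (intro sum_mono order_trans[OF norm_blinfun] mult_left_mono norm_le_vec_norm) auto
    finally show "norm (mat_apply n a \<xi> i) \<le> (\<Sum>j<n. norm (a i j) * vec_norm n \<xi>)" .
  qed
  finally show "vec_norm n (mat_apply n a \<xi>) \<le> (\<Sum>i<n. \<Sum>j<n. norm (a i j)) * vec_norm n \<xi>"
    by (simp add: sum_distrib_right)
qed

lemma mat_norm_upper: "vec_norm n (mat_apply n a \<xi>) / vec_norm n \<xi> \<le> mat_norm n a"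
proof -
  obtain K where K: "0 \<le> K" "\<And>\<xi>. vec_norm n (mat_apply n a \<xi>) \<le> K * vec_norm n \<xi>"
    using mat_apply_bounded by blast
  have "vec_norm n (mat_apply n a \<xi>) / vec_norm n \<xi> \<le> K" for \<xi>
    using K(2)[of \<xi>] K(1) vec_norm_nonneg[of n \<xi>]
    by (cases "vec_norm n \<xi> = 0") (simp_all add: pos_divide_le_eq order_less_le)
  then show ?thesis
    unfolding mat_norm_altdef by (intro cSUP_upper bdd_aboveI2[where M = K]) auto
qed

lemma mat_norm_nonneg: "0 \<le> mat_norm n a"
  by (rule order_trans[OF _ mat_norm_upper[of n a "\<lambda>_. 0"]]) simp

lemma mat_apply_norm: "vec_norm n (mat_apply n a \<xi>) \<le> mat_norm n a * vec_norm n \<xi>"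
proof (cases "vec_norm n \<xi> = 0")
  case True
  then show ?thesis using mat_apply_bounded[of n a] by (metis mult_zero_right)
next
  case False
  then show ?thesis
    using mat_norm_upper[of n a \<xi>] vec_norm_nonneg[of n \<xi>]
    by (simp add: pos_divide_le_eq order_less_le)
qed

lemma mat_norm_le:
  assumes "0 \<le> c" "\<And>\<xi>. vec_norm n (mat_apply n a \<xi>) \<le> c * vec_norm n \<xi>"
  shows "mat_norm n a \<le> c"
  unfolding mat_norm_altdef
proof (rule cSUP_least)
  fix \<xi>
  show "vec_norm n (mat_apply n a \<xi>) / vec_norm n \<xi> \<le> c"
    using assms(2)[of \<xi>] assms(1) vec_norm_nonneg[of n \<xi>]
    by (cases "vec_norm n \<xi> = 0") (simp_all add: pos_divide_le_eq order_less_le)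
qed simp

text \<open>The quotient norm never exceeds the norm, so only one inequality has content.\<close>

lemma completely_isometric_quotient_iff:
  assumes "0 \<in> I"
  shows "completely_isometric_on mat_norm quot_mat_norm X (quot_map I) \<longleftrightarrow>
    (\<forall>n x y. (\<forall>i<n. \<forall>j<n. x i j \<in> X \<and> y i j \<in> I) \<longrightarrow>
      mat_norm n x \<le> mat_norm n (\<lambda>i j. x i j + y i j))" (is "?L \<longleftrightarrow> ?R")
proof -
  let ?S = "\<lambda>n x. {mat_norm n b | b. \<forall>i<n. \<forall>j<n. b i j \<in> quot_map I (x i j)}"
  have bdd: "bdd_below (?S n x)" for n :: nat and x :: "nat \<Rightarrow> nat \<Rightarrow> 'a \<Rightarrow>\<^sub>L 'a"
    by (rule bdd_belowI[of _ 0]) (auto simp: mat_norm_nonneg)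
  have self: "mat_norm n x \<in> ?S n x" for n :: nat and x :: "nat \<Rightarrow> nat \<Rightarrow> 'a \<Rightarrow>\<^sub>L 'a"
    using assms by (force simp: quot_map_def)
  show ?thesis
  proof
    assume L: ?L
    show ?R
    proof (intro allI impI)
      fix n :: nat and x y assume xy: "\<forall>i<n. \<forall>j<n. x i j \<in> X \<and> y i j \<in> I"
      have "Inf (?S n x) \<le> mat_norm n (\<lambda>i j. x i j + y i j)"
        using xy by (intro cInf_lower bdd) (force simp: quot_map_def)
      moreover have "Inf (?S n x) = mat_norm n x"
        using L xy unfolding completely_isometric_on_def quot_mat_norm_def by blast
      ultimately show "mat_norm n x \<le> mat_norm n (\<lambda>i j. x i j + y i j)" by simp
    qed
  next
    assume R: ?R
    have "Inf (?S n x) = mat_norm n x" if x: "\<forall>i<n. \<forall>j<n. x i j \<in> X" for n x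
    proof (rule antisym)
      show "Inf (?S n x) \<le> mat_norm n x" by (intro cInf_lower bdd self)
      show "mat_norm n x \<le> Inf (?S n x)"
      proof (rule cInf_greatest)
        fix r assume "r \<in> ?S n x"
        then obtain b where b: "r = mat_norm n b" "\<forall>i<n. \<forall>j<n. b i j \<in> quot_map I (x i j)" by blast
        have "mat_norm n x \<le> mat_norm n (\<lambda>i j. x i j + (b i j - x i j))"
          using b(2) x by (intro R[rule_format]) (fastforce simp: quot_map_def)
        then show "mat_norm n x \<le> r" by (simp add: b)
      qed (use self in blast)
    qed
    then show ?L unfolding completely_isometric_on_def quot_mat_norm_def by blast
  qed
qed

text \<open>The norm detects accretivity through the expansion
  \<open>\<parallel>(1 - t v) \<xi>\<parallel>\<^sup>2 = \<parallel>\<xi>\<parallel>\<^sup>2 - 2 t Re \<langle>v \<xi>, \<xi>\<rangle> + t\<^sup>2 \<parallel>v \<xi>\<parallel>\<^sup>2\<close>: for accretive \<open>v\<close> it bounds \<open>\<parallel>1 - t v\<parallel>\<^sup>2\<close> by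
  \<open>1 + t\<^sup>2 K\<^sup>2\<close>, where \<open>K\<close> is a bound for \<open>v\<close>, and if \<open>\<parallel>1 - t w\<parallel>\<close> obeys the same bound then letting
  \<open>t \<rightarrow> 0\<close> gives \<open>Re \<langle>w \<xi>, \<xi>\<rangle> \<ge> 0\<close>.\<close>

lemma accretive_of_norm:
  fixes v :: "nat \<Rightarrow> nat \<Rightarrow> 'a::chilbert_space \<Rightarrow>\<^sub>L 'a"
  defines "M \<equiv> \<lambda>t w i j. (if i = j then id_blinfun else 0) + (- t) *\<^sub>R (w i j :: 'a \<Rightarrow>\<^sub>L 'a)"
  assumes acc: "accretive {..<n} v"
    and le: "\<And>t. 0 < t \<Longrightarrow> mat_norm n (M t w) \<le> mat_norm n (M t v)"
  shows "accretive {..<n} w"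
proof -
  have ap: "mat_apply n (M t u) \<xi> i = \<xi> i - t *\<^sub>R mat_apply n u \<xi> i" if "i < n" for t u \<xi> i
  proof -
    have "mat_apply n (M t u) \<xi> i =
        (\<Sum>j<n. if j = i then \<xi> j else 0) - t *\<^sub>R mat_apply n u \<xi> i"
      unfolding mat_apply_def M_def scaleR_sum_right sum_subtractf[symmetric]
      by (intro sum.cong) (auto simp: blinfun.add_left blinfun.scaleR_left blinfun.minus_left
        blinfun.diff_left)
    then show ?thesis using that by simp
  qed
  have sq: "(vec_norm n (mat_apply n (M t u) \<xi>))\<^sup>2 =
      (vec_norm n \<xi>)\<^sup>2 - 2 * t * quad {..<n} u \<xi> + t\<^sup>2 * (vec_norm n (mat_apply n u \<xi>))\<^sup>2" for t u \<xi>
    unfolding vec_norm_square quad_altdef sum_distrib_left sum_subtractf[symmetric] sum.distrib[symmetric]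
    by (intro sum.cong)
      (auto simp: ap norm_diff_square cinner_scaleR_right power_mult_distrib
        Re_cinner_commute[of "mat_apply n u \<xi> _"])
  obtain K where K: "0 \<le> K" "\<And>\<xi>. vec_norm n (mat_apply n v \<xi>) \<le> K * vec_norm n \<xi>"
    using mat_apply_bounded by blast
  have low: "- (t * (K\<^sup>2 * (vec_norm n \<xi>)\<^sup>2)) \<le> 2 * quad {..<n} w \<xi>" if t: "0 < t" for t \<xi>
  proof -
    have "mat_norm n (M t v) \<le> sqrt (1 + t\<^sup>2 * K\<^sup>2)"
    proof (rule mat_norm_le)
      fix \<xi>
      have "(vec_norm n (mat_apply n v \<xi>))\<^sup>2 \<le> K\<^sup>2 * (vec_norm n \<xi>)\<^sup>2"
        using power_mono[OF K(2), where n = 2] by (simp add: power_mult_distrib)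
      then have "t\<^sup>2 * (vec_norm n (mat_apply n v \<xi>))\<^sup>2 \<le> t\<^sup>2 * (K\<^sup>2 * (vec_norm n \<xi>)\<^sup>2)"
        by (rule mult_left_mono) simp
      moreover have "0 \<le> 2 * t * quad {..<n} v \<xi>" using acc t by (simp add: accretive_def)
      ultimately have "(vec_norm n (mat_apply n (M t v) \<xi>))\<^sup>2 \<le> (1 + t\<^sup>2 * K\<^sup>2) * (vec_norm n \<xi>)\<^sup>2"
        unfolding sq by (simp add: algebra_simps)
      then show "vec_norm n (mat_apply n (M t v) \<xi>) \<le> sqrt (1 + t\<^sup>2 * K\<^sup>2) * vec_norm n \<xi>"
        using real_sqrt_le_mono by (fastforce simp: real_sqrt_mult)
    qed simp
    then have N: "mat_norm n (M t w) \<le> sqrt (1 + t\<^sup>2 * K\<^sup>2)" using le[OF t] by linarith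
    have "vec_norm n (mat_apply n (M t w) \<xi>) \<le> sqrt (1 + t\<^sup>2 * K\<^sup>2) * vec_norm n \<xi>"
      using order_trans[OF mat_apply_norm mult_right_mono[OF N]] by simp
    from power_mono[OF this, of 2]
    have "(vec_norm n (mat_apply n (M t w) \<xi>))\<^sup>2 \<le> (1 + t\<^sup>2 * K\<^sup>2) * (vec_norm n \<xi>)\<^sup>2"
      by (simp add: power_mult_distrib)
    moreover have "0 \<le> t\<^sup>2 * (vec_norm n (mat_apply n w \<xi>))\<^sup>2" by simp
    ultimately have "t * (- (t * (K\<^sup>2 * (vec_norm n \<xi>)\<^sup>2))) \<le> t * (2 * quad {..<n} w \<xi>)"
      unfolding sq by (simp add: algebra_simps power2_eq_square)
    then show ?thesis using t by (simp only: mult_le_cancel_left_pos)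
  qed
  show ?thesis unfolding accretive_def
  proof
    fix \<xi> :: "nat \<Rightarrow> 'a"
    define L where "L = K\<^sup>2 * (vec_norm n \<xi>)\<^sup>2"
    have "((\<lambda>t. - (t * L)) \<longlongrightarrow> - (0 * L)) (at_right 0)" by (intro tendsto_intros)
    moreover have "\<forall>\<^sub>F t in at_right 0. - (t * L) \<le> 2 * quad {..<n} w \<xi>"
      using low by (auto simp: eventually_at_right_field L_def intro!: exI[of _ 1])
    ultimately have "- (0 * L) \<le> 2 * quad {..<n} w \<xi>"
      by (rule tendsto_upperbound) simp
    then show "0 \<le> quad {..<n} w \<xi>" by simp
  qed
qed

text \<open>Conversely, accretivity of larger matrices detects the norm: the real part of this block matrix
  is \<open>[[c, a], [a\<^sup>*, c]]\<close>, which is positive exactly when \<open>\<parallel>a\<parallel> \<le> c\<close>. The upper triangular form avoids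
  adjoints, so that the entries stay in \<open>X + I\<close>.\<close>

definition norm_block ::
    "real \<Rightarrow> (nat \<Rightarrow> nat \<Rightarrow> 'a::chilbert_space \<Rightarrow>\<^sub>L 'a) \<Rightarrow> nat + nat \<Rightarrow> nat + nat \<Rightarrow> 'a \<Rightarrow>\<^sub>L 'a" where
  "norm_block c a p q = (case (p, q) of
      (Inl i, Inl j) \<Rightarrow> if i = j then c *\<^sub>R id_blinfun else 0
    | (Inr i, Inr j) \<Rightarrow> if i = j then c *\<^sub>R id_blinfun else 0
    | (Inl i, Inr j) \<Rightarrow> 2 *\<^sub>R a i j
    | (Inr i, Inl j) \<Rightarrow> 0)"

lemma quad_norm_block:
  "quad ({..<n} <+> {..<n}) (norm_block c a) \<zeta> =
    c * (vec_norm n (\<zeta> \<circ> Inl))\<^sup>2 + c * (vec_norm n (\<zeta> \<circ> Inr))\<^sup>2 +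
    2 * (\<Sum>i<n. Re (cinner (mat_apply n a (\<zeta> \<circ> Inr) i) (\<zeta> (Inl i))))"
proof -
  have diag: "(\<Sum>j<n. cinner (blinfun_apply (if i = j then c *\<^sub>R id_blinfun else 0) (\<xi> j)) (\<xi> i)) =
      of_real (c * (norm (\<xi> i))\<^sup>2)" if "i < n" for i and \<xi> :: "nat \<Rightarrow> 'a"
  proof -
    have "(\<Sum>j<n. cinner (blinfun_apply (if i = j then c *\<^sub>R id_blinfun else 0) (\<xi> j)) (\<xi> i)) =
        (\<Sum>j<n. if j = i then c * cinner (\<xi> j) (\<xi> i) else 0)"
      by (intro sum.cong) (auto simp: blinfun.scaleR_left cinner_linear)
    then show ?thesis using that by (simp add: cinner_self)
  qed
  have off: "(\<Sum>j<n. cinner (blinfun_apply (2 *\<^sub>R a i j) (\<zeta> (Inr j))) (\<zeta> (Inl i))) =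
      2 * cinner (mat_apply n a (\<zeta> \<circ> Inr) i) (\<zeta> (Inl i))" for i
    by (simp add: mat_apply_def blinfun.scaleR_left cinner_linear cinner_sum_left sum_distrib_left)
  show ?thesis
    unfolding quad_def vec_norm_square sum_distrib_left
    by (simp add: sum.Plus norm_block_def off diag[where \<xi> = "\<lambda>i. \<zeta> (Inl i)"]
        diag[where \<xi> = "\<lambda>i. \<zeta> (Inr i)"] sum.distrib)
qed

lemma accretive_norm_block:
  assumes "mat_norm n a \<le> c"
  shows "accretive ({..<n} <+> {..<n}) (norm_block c a)"
  unfolding accretive_def
proof
  fix \<zeta> :: "nat + nat \<Rightarrow> 'a"
  let ?\<xi> = "\<zeta> \<circ> Inl" and ?\<eta> = "\<zeta> \<circ> Inr"
  define S where "S = (\<Sum>i<n. Re (cinner (mat_apply n a ?\<eta> i) (\<zeta> (Inl i))))"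
  have c: "0 \<le> c" using assms mat_norm_nonneg[of n a] by linarith
  have "- Re (cinner (mat_apply n a ?\<eta> i) (?\<xi> i)) \<le> \<bar>norm (mat_apply n a ?\<eta> i)\<bar> * \<bar>norm (?\<xi> i)\<bar>" for i
    using Re_cinner_le[of "- mat_apply n a ?\<eta> i" "?\<xi> i"] by (simp add: cinner_linear)
  then have "(\<Sum>i<n. - Re (cinner (mat_apply n a ?\<eta> i) (?\<xi> i))) \<le>
      (\<Sum>i<n. \<bar>norm (mat_apply n a ?\<eta> i)\<bar> * \<bar>norm (?\<xi> i)\<bar>)" by (rule sum_mono)
  also have "\<dots> \<le> vec_norm n (mat_apply n a ?\<eta>) * vec_norm n ?\<xi>"
    unfolding vec_norm_def by (rule L2_set_mult_ineq)
  also have "\<dots> \<le> (c * vec_norm n ?\<eta>) * vec_norm n ?\<xi>"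
    by (intro mult_right_mono order_trans[OF mat_apply_norm] assms) auto
  finally have "- S \<le> c * (vec_norm n ?\<eta> * vec_norm n ?\<xi>)"
    by (simp add: S_def sum_negf mult.assoc)
  moreover have "c * (2 * vec_norm n ?\<eta> * vec_norm n ?\<xi>) \<le> c * ((vec_norm n ?\<xi>)\<^sup>2 + (vec_norm n ?\<eta>)\<^sup>2)"
    by (intro mult_left_mono c)
      (use sum_squares_bound[of "vec_norm n ?\<eta>" "vec_norm n ?\<xi>"] in linarith)
  ultimately show "0 \<le> quad ({..<n} <+> {..<n}) (norm_block c a) \<zeta>"
    unfolding quad_norm_block S_def[symmetric] by (simp add: algebra_simps)
qed

lemma mat_norm_le_of_accretive:
  assumes acc: "accretive ({..<n} <+> {..<n}) (norm_block c a)" and c: "0 < c"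
  shows "mat_norm n a \<le> c"
proof (rule mat_norm_le)
  fix \<eta> :: "nat \<Rightarrow> 'a"
  \<comment> \<open>the vector that minimises the form of the block matrix for a given second component \<open>\<eta>\<close>\<close>
  define \<zeta> where "\<zeta> p = (case p of Inl i \<Rightarrow> (- 1 / c) *\<^sub>R mat_apply n a \<eta> i | Inr i \<Rightarrow> \<eta> i)" for p
  let ?N = "(vec_norm n (mat_apply n a \<eta>))\<^sup>2"
  have r: "\<zeta> \<circ> Inr = \<eta>" by (auto simp: \<zeta>_def)
  have l: "(vec_norm n (\<zeta> \<circ> Inl))\<^sup>2 = ?N / c\<^sup>2"
    by (simp add: vec_norm_square \<zeta>_def sum_divide_distrib power_divide)
  have m: "(\<Sum>i<n. Re (cinner (mat_apply n a \<eta> i) (\<zeta> (Inl i)))) = - ?N / c"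
    by (simp add: vec_norm_square \<zeta>_def cinner_linear cinner_self sum_divide_distrib sum_negf)
  have "0 \<le> c * (?N / c\<^sup>2) + c * (vec_norm n \<eta>)\<^sup>2 + 2 * (- ?N / c)"
    using acc quad_norm_block[of n c a \<zeta>] unfolding accretive_def r l m by metis
  moreover have "c * (?N / c\<^sup>2) = ?N / c" using c by (simp add: power2_eq_square)
  ultimately have "?N / c \<le> c * (vec_norm n \<eta>)\<^sup>2" by simp
  then have "?N \<le> c * (vec_norm n \<eta>)\<^sup>2 * c"
    by (simp only: pos_divide_le_eq[OF c])
  also have "\<dots> = (c * vec_norm n \<eta>)\<^sup>2" by (simp add: power2_eq_square)
  finally have "?N \<le> (c * vec_norm n \<eta>)\<^sup>2" .
  then show "vec_norm n (mat_apply n a \<eta>) \<le> c * vec_norm n \<eta>"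
    by (rule power2_le_imp_le) (use c in simp)
qed (use c in simp)

lemma completely_isometric_iff_accretive_boundary:
  assumes X: "complex_vector.subspace X" "id_blinfun \<in> X" and I: "complex_vector.subspace I"
  shows "completely_isometric_on mat_norm quot_mat_norm X (quot_map I) \<longleftrightarrow> accretive_boundary X I"
proof -
  have X0: "0 \<in> X" and I0: "0 \<in> I" using X I by (auto simp: complex_vector.subspace_0)
  have Xr: "r *\<^sub>R x \<in> X" if "x \<in> X" for r x
    using that X by (simp add: scaleR_scaleC complex_vector.subspace_scale)
  have Ir: "r *\<^sub>R x \<in> I" if "x \<in> I" for r x
    using that I by (simp add: scaleR_scaleC complex_vector.subspace_scale)
  show ?thesis
    unfolding completely_isometric_quotient_iff[OF I0]
  proof
    assume N: "\<forall>n x y. (\<forall>i<n. \<forall>j<n. x i j \<in> X \<and> y i j \<in> I) \<longrightarrow>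
      mat_norm n x \<le> mat_norm n (\<lambda>i j. x i j + y i j)"
    show "accretive_boundary X I"
      unfolding accretive_boundary_def
    proof (intro allI impI)
      fix n :: nat and x y
      assume xy: "\<forall>i<n. \<forall>j<n. x i j \<in> X \<and> y i j \<in> I"
        and acc: "accretive {..<n} (\<lambda>i j. x i j + y i j)"
      show "accretive {..<n} x"
      proof (rule accretive_of_norm[OF acc])
        fix t :: real
        have "mat_norm n (\<lambda>i j. (if i = j then id_blinfun else 0) + (- t) *\<^sub>R x i j) \<le>
          mat_norm n (\<lambda>i j. ((if i = j then id_blinfun else 0) + (- t) *\<^sub>R x i j) + (- t) *\<^sub>R y i j)"
          using xy X0 X I Xr Ir
          by (intro N[rule_format]) (auto intro!: complex_vector.subspace_add
            complex_vector.subspace_diff complex_vector.subspace_neg)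
        then show "mat_norm n (\<lambda>i j. (if i = j then id_blinfun else 0) + (- t) *\<^sub>R x i j) \<le>
          mat_norm n (\<lambda>i j. (if i = j then id_blinfun else 0) + (- t) *\<^sub>R (x i j + y i j))"
          by (simp add: algebra_simps)
      qed
    qed
  next
    assume B: "accretive_boundary X I"
    show "\<forall>n x y. (\<forall>i<n. \<forall>j<n. x i j \<in> X \<and> y i j \<in> I) \<longrightarrow>
      mat_norm n x \<le> mat_norm n (\<lambda>i j. x i j + y i j)"
    proof (intro allI impI)
      fix n :: nat and x y assume xy: "\<forall>i<n. \<forall>j<n. x i j \<in> X \<and> y i j \<in> I"
      let ?b = "\<lambda>i j. x i j + y i j"
      have "mat_norm n x \<le> c" if c: "mat_norm n ?b < c" for c
      proof (rule mat_norm_le_of_accretive)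
        define z where "z p q = (case (p, q) of (Inl i, Inr j) \<Rightarrow> 2 *\<^sub>R y i j | _ \<Rightarrow> 0)"
          for p q :: "nat + nat"
        have "accretive ({..<n} <+> {..<n}) (norm_block c ?b)"
          using c by (intro accretive_norm_block) simp
        also have "norm_block c ?b = (\<lambda>p q. norm_block c x p q + z p q)"
          by (auto simp: norm_block_def z_def fun_eq_iff scaleR_add_right split: sum.split)
        finally show "accretive ({..<n} <+> {..<n}) (norm_block c x)"
          by (rule accretive_boundaryD[OF B, rotated -1])
            (use xy X0 I0 X Xr Ir in \<open>auto simp: norm_block_def z_def\<close>)
        show "0 < c" using c mat_norm_nonneg[of n ?b] by linarith
      qed
      then show "mat_norm n x \<le> mat_norm n ?b" by (rule dense_ge)
    qed
  qed
qed

section \<open>Extension of completely positive maps\<close>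

text \<open>The unital completely positive maps of \<open>B(H)\<close>. They are represented by functions on the type of all real-linear
  operators, so every condition is restricted to \<open>BH\<close>.\<close>

definition ucp :: "(('a::chilbert_space \<Rightarrow>\<^sub>L 'a) \<Rightarrow> 'a \<Rightarrow>\<^sub>L 'a) \<Rightarrow> bool" where
  "ucp \<phi> \<longleftrightarrow> (\<forall>a\<in>BH. \<phi> a \<in> BH) \<and> (\<forall>a\<in>BH. \<forall>b\<in>BH. \<phi> (a + b) = \<phi> a + \<phi> b) \<and>
    (\<forall>c. \<forall>a\<in>BH. \<phi> (c *\<^sub>C a) = c *\<^sub>C \<phi> a) \<and> \<phi> id_blinfun = id_blinfun \<and>
    (\<forall>n v. (\<forall>i<n. \<forall>j<n. v i j \<in> BH) \<longrightarrow> accretive {..<n::nat} v \<longrightarrow>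
      accretive {..<n} (\<lambda>i j. \<phi> (v i j)))"

lemma BH_scaleR: "a \<in> BH \<Longrightarrow> r *\<^sub>R a \<in> BH"
  by (simp add: scaleR_scaleC BH_scale)

lemma BH_uminus: "a \<in> BH \<Longrightarrow> - a \<in> BH"
  by (rule complex_vector.subspace_neg[OF subspace_BH])

lemma quad_single:
  assumes A: "finite A" "\<eta> \<in> A" "\<xi> \<in> A"
  shows "quad A (\<lambda>p q. if p = \<eta> \<and> q = \<xi> then a else 0) \<zeta> =
    Re (cinner (blinfun_apply a (\<zeta> \<xi>)) (\<zeta> \<eta>))"
proof -
  have "(\<Sum>q\<in>A. cinner (blinfun_apply (if p = \<eta> \<and> q = \<xi> then a else 0) (\<zeta> q)) (\<zeta> p)) =
      (if p = \<eta> then cinner (blinfun_apply a (\<zeta> \<xi>)) (\<zeta> \<eta>) else 0)" for p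
  proof -
    have "(\<Sum>q\<in>A. cinner (blinfun_apply (if p = \<eta> \<and> q = \<xi> then a else 0) (\<zeta> q)) (\<zeta> p)) =
        (\<Sum>q\<in>A. if q = \<xi> then (if p = \<eta> then cinner (blinfun_apply a (\<zeta> \<xi>)) (\<zeta> \<eta>) else 0) else 0)"
      by (intro sum.cong) auto
    then show ?thesis using A by simp
  qed
  then show ?thesis using A by (simp add: quad_def)
qed

lemma quad_superset:
  assumes "finite B" "A \<subseteq> B" "\<And>i j. i \<notin> A \<or> j \<notin> A \<Longrightarrow> v i j = 0"
  shows "quad B v \<zeta> = quad A v \<zeta>"
proof -
  have "(\<Sum>i\<in>B. \<Sum>j\<in>B. cinner (blinfun_apply (v i j) (\<zeta> j)) (\<zeta> i)) =
      (\<Sum>i\<in>A. \<Sum>j\<in>B. cinner (blinfun_apply (v i j) (\<zeta> j)) (\<zeta> i))"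
    using assms by (intro sum.mono_neutral_right) auto
  also have "\<dots> = (\<Sum>i\<in>A. \<Sum>j\<in>A. cinner (blinfun_apply (v i j) (\<zeta> j)) (\<zeta> i))"
    using assms by (intro sum.cong refl sum.mono_neutral_right) auto
  finally show ?thesis by (simp add: quad_def)
qed

text \<open>The hypotheses only ask for complex linearity of \<open>f\<close> in the operator; sesquilinearity and boundedness in the vectors
  follow from positivity, as in the GNS construction. Positivity on the matrix with form
  \<open>t K \<parallel>\<Sum> u\<^sub>j \<zeta>\<^sub>j\<parallel>\<^sup>2 + 2 Re \<langle>a (\<Sum> u\<^sub>j \<zeta>\<^sub>j), z\<rangle> + (K/t) \<parallel>z\<parallel>\<^sup>2\<close> with \<open>\<parallel>a\<parallel> \<le> K\<close>
  yields a Cauchy--Schwarz inequality which shows that every linear relation between vectors \<open>\<xi>\<^sub>j\<close> also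
  holds between the functionals \<open>f a \<xi>\<^sub>j\<close>.\<close>

lemma ucp_of_forms:
  fixes f :: "('a::chilbert_space \<Rightarrow>\<^sub>L 'a) \<Rightarrow> 'a \<Rightarrow> 'a \<Rightarrow> complex"
  assumes add: "\<And>a b \<xi> \<eta>. a \<in> BH \<Longrightarrow> b \<in> BH \<Longrightarrow> f (a + b) \<xi> \<eta> = f a \<xi> \<eta> + f b \<xi> \<eta>"
    and scale: "\<And>c a \<xi> \<eta>. a \<in> BH \<Longrightarrow> f (c *\<^sub>C a) \<xi> \<eta> = c * f a \<xi> \<eta>"
    and unit: "\<And>\<xi> \<eta>. f id_blinfun \<xi> \<eta> = cinner \<xi> \<eta>"
    and pos: "\<And>n v \<xi>. (\<And>i j. i < n \<Longrightarrow> j < n \<Longrightarrow> v i j \<in> BH) \<Longrightarrow> accretive {..<n::nat} v \<Longrightarrow>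
      0 \<le> Re (\<Sum>i<n. \<Sum>j<n. f (v i j) (\<xi> j) (\<xi> i))"
  obtains \<phi> where "ucp \<phi>"
    "\<And>a \<xi> \<eta>. a \<in> BH \<Longrightarrow> cinner (blinfun_apply (\<phi> a) \<xi>) \<eta> = f a \<xi> \<eta>"
proof -
  have pos': "0 \<le> Re (\<Sum>i\<in>A. \<Sum>j\<in>A. f (v i j) (\<xi> j) (\<xi> i))"
    if A: "finite A" and v: "\<And>i j. i \<in> A \<Longrightarrow> j \<in> A \<Longrightarrow> v i j \<in> BH" and acc: "accretive A v"
    for A :: "'i set" and v \<xi>
  proof -
    obtain h where "bij_betw h {0..<card A} A" using ex_bij_betw_nat_finite[OF A] by blast
    then have h: "bij_betw h {..<card A} A" by (simp add: atLeast0LessThan)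
    have "0 \<le> Re (\<Sum>i<card A. \<Sum>j<card A. f (v (h i) (h j)) (\<xi> (h j)) (\<xi> (h i)))"
      using acc bij_betwE[OF h] by (intro pos v) (auto simp: accretive_reindex[OF h])
    then show ?thesis by (simp add: sum.reindex_bij_betw[OF h, symmetric])
  qed
  have fR: "f (r *\<^sub>R a) \<xi> \<eta> = r * f a \<xi> \<eta>" if "a \<in> BH" for r a \<xi> \<eta>
    using that by (simp add: scaleR_scaleC scale)
  \<comment> \<open>The form of the skew-adjoint matrix \<open>[[0, - r a\<^sup>*], [r a, 0]]\<close> has real part zero for both signs of \<open>r\<close>.\<close>
  have sym: "f (adj a) \<eta> \<xi> = cnj (f a \<xi> \<eta>)" if a: "a \<in> BH" for a \<xi> \<eta>
  proof -
    have *: "Re (f (adj b) \<eta> \<xi>) = Re (f b \<xi> \<eta>)" if b: "b \<in> BH" for b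
    proof -
      define v where "v r p q = (if p \<and> \<not> q then r *\<^sub>R b else if \<not> p \<and> q then (- r) *\<^sub>R adj b else 0)"
        for r :: real and p q
      have acc: "accretive UNIV (v r)" for r
      proof -
        have "quad UNIV (v r) \<zeta> = 0" for \<zeta>
          by (simp add: quad_def UNIV_bool v_def blinfun.scaleR_left blinfun.minus_left cinner_linear
              cinner_adj_left[OF b] Re_cinner_commute[of "\<zeta> True"])
        then show ?thesis by (simp add: accretive_def)
      qed
      have "0 \<le> Re (\<Sum>i\<in>UNIV. \<Sum>j\<in>UNIV. f (v r i j)
          (if j then \<eta> else \<xi>) (if i then \<eta> else \<xi>))" for r
        using b adj_in_BH[OF b] by (intro pos' acc) (auto simp: v_def BH_scaleR BH_zero BH_uminus)
      moreover have "f 0 x y = 0" for x y using scale[OF BH_zero, of 0 x y] by simp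
      ultimately have "0 \<le> r * (Re (f b \<xi> \<eta>) - Re (f (adj b) \<eta> \<xi>))" for r
        using b adj_in_BH[OF b] by (simp add: UNIV_bool v_def fR algebra_simps del: scaleR_minus_left)
      from this[of 1] this[of "- 1"] show ?thesis by simp
    qed
    show ?thesis
    proof (rule complex_eqI)
      show "Im (f (adj a) \<eta> \<xi>) = Im (cnj (f a \<xi> \<eta>))"
        using *[OF BH_scale[OF a, of "\<i>"]] scale[OF adj_in_BH[OF a], of "cnj \<i>" \<eta> \<xi>]
        by (simp add: adj_scaleC scale a)
    qed (simp add: *[OF a])
  qed
  \<comment> \<open>The index \<open>None\<close> carries \<open>\<eta>\<close>, the index \<open>Some j\<close> carries \<open>\<xi>\<^sub>j\<close>.\<close>
  have main: "0 \<le> t * K * (norm (\<Sum>j\<in>J. u j *\<^sub>C \<xi> j))\<^sup>2 + 2 * Re (\<Sum>j\<in>J. u j * f a (\<xi> j) \<eta>) +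
      K / t * (norm \<eta>)\<^sup>2"
    if a: "a \<in> BH" "norm a \<le> K" "0 < t" and J: "finite J"
    for a t K and J :: "nat set" and u \<xi> \<eta>
  proof -
    define v where "v p q = (case (p, q) of
        (Some i, Some j) \<Rightarrow> (of_real (t * K) * cnj (u i) * u j) *\<^sub>C id_blinfun
      | (None, Some j) \<Rightarrow> (2 * u j) *\<^sub>C a
      | (None, None) \<Rightarrow> of_real (K / t) *\<^sub>C id_blinfun
      | (Some i, None) \<Rightarrow> 0)" for p q
    define A where "A = insert None (Some ` J)"
    have sumA: "(\<Sum>p\<in>A. g p) = g None + (\<Sum>j\<in>J. g (Some j))" for g :: "nat option \<Rightarrow> complex"
      using J by (simp add: A_def sum.reindex)
    have f0: "f 0 x y = 0" for x y using scale[OF BH_zero, of 0 x y] by simp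
    have square: "(\<Sum>i\<in>J. \<Sum>j\<in>J. of_real (t * K) * cnj (u i) * u j * cinner (x j) (x i)) =
        of_real (t * K * (norm (\<Sum>j\<in>J. u j *\<^sub>C x j))\<^sup>2)" for x :: "nat \<Rightarrow> 'a"
      unfolding of_real_mult cinner_self[symmetric]
      by (simp add: cinner_sum_left cinner_sum_right cinner_linear sum_distrib_left mult_ac)
    have K: "0 \<le> K" using a(2) norm_ge_zero[of a] by linarith
    have acc: "accretive A v" unfolding accretive_def
    proof
      fix \<zeta> :: "nat option \<Rightarrow> 'a"
      define w where "w = (\<Sum>j\<in>J. u j *\<^sub>C \<zeta> (Some j))"
      have "(\<Sum>p\<in>A. \<Sum>q\<in>A. cinner (blinfun_apply (v p q) (\<zeta> q)) (\<zeta> p)) =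
          of_real (t * K * (norm w)\<^sup>2) + 2 * cinner (blinfun_apply a w) (\<zeta> None) +
          of_real (K / t * (norm (\<zeta> None))\<^sup>2)"
        using square[of "\<lambda>j. \<zeta> (Some j)"] unfolding sumA w_def
        by (simp add: v_def cinner_linear cinner_self sum.distrib blinfun.sum_right
            BH_scaleC[OF a(1)] cinner_sum_left sum_distrib_left mult.assoc)
      then have "quad A v \<zeta> = t * K * (norm w)\<^sup>2 + 2 * Re (cinner (blinfun_apply a w) (\<zeta> None)) +
          K / t * (norm (\<zeta> None))\<^sup>2"
        by (simp add: quad_def)
      moreover have "- Re (cinner (blinfun_apply a w) (\<zeta> None)) \<le> K * norm w * norm (\<zeta> None)"
      proof -
        have "- Re (cinner (blinfun_apply a w) (\<zeta> None)) \<le> norm (blinfun_apply a w) * norm (\<zeta> None)"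
          using Re_cinner_le[of "- blinfun_apply a w" "\<zeta> None"] by (simp add: cinner_linear)
        also have "\<dots> \<le> K * norm w * norm (\<zeta> None)"
          by (intro mult_right_mono order_trans[OF norm_blinfun] a) auto
        finally show ?thesis .
      qed
      moreover have "0 \<le> K / t * (t * norm w - norm (\<zeta> None))\<^sup>2" using K a(3) by simp
      then have "0 \<le> t * K * (norm w)\<^sup>2 - 2 * (K * norm w * norm (\<zeta> None)) + K / t * (norm (\<zeta> None))\<^sup>2"
        using a(3) by (simp add: power2_eq_square field_simps)
      ultimately show "0 \<le> quad A v \<zeta>" by linarith
    qed
    have "0 \<le> Re (\<Sum>p\<in>A. \<Sum>q\<in>A. f (v p q) (case q of None \<Rightarrow> \<eta> | Some j \<Rightarrow> \<xi> j)
        (case p of None \<Rightarrow> \<eta> | Some j \<Rightarrow> \<xi> j))"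
      using J a(1) by (intro pos' acc)
        (auto simp: A_def v_def BH_scale BH_id BH_zero split: option.split)
    also have "(\<Sum>p\<in>A. \<Sum>q\<in>A. f (v p q) (case q of None \<Rightarrow> \<eta> | Some j \<Rightarrow> \<xi> j)
        (case p of None \<Rightarrow> \<eta> | Some j \<Rightarrow> \<xi> j)) =
        of_real (t * K * (norm (\<Sum>j\<in>J. u j *\<^sub>C \<xi> j))\<^sup>2) + 2 * (\<Sum>j\<in>J. u j * f a (\<xi> j) \<eta>) +
        of_real (K / t * (norm \<eta>)\<^sup>2)"
      using square[of \<xi>] unfolding sumA
      by (simp add: v_def scale BH_id a(1) unit f0 sum.distrib sum_distrib_left
          cinner_self mult.assoc)
    finally show ?thesis by simp
  qed
  \<comment> \<open>If \<open>\<Sum> u\<^sub>j \<xi>\<^sub>j = 0\<close>, the only other term left is the one with \<open>K / t\<close>, and it tends to \<open>0\<close> for \<open>t = 1 / s\<close>, \<open>s \<rightarrow> 0\<close>.\<close>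
  have relation: "(\<Sum>j\<in>J. u j * f a (\<xi> j) \<eta>) = 0"
    if a: "a \<in> BH" and J: "finite J" and z: "(\<Sum>j\<in>J. u j *\<^sub>C \<xi> j) = 0"
    for a and J :: "nat set" and u \<xi> \<eta>
  proof -
    have ge: "0 \<le> Re (\<Sum>j\<in>J. u j * f b (\<xi> j) \<eta>)" if b: "b \<in> BH" for b
    proof -
      define L where "L = norm b * (norm \<eta>)\<^sup>2"
      define R where "R = Re (\<Sum>j\<in>J. u j * f b (\<xi> j) \<eta>)"
      have "- (s * L) \<le> 2 * R" if "0 < s" for s
        using main[OF b order_refl _ J, of "1 / s" u \<xi> \<eta>] z that by (simp add: L_def R_def mult_ac)
      then have "\<forall>\<^sub>F s in at_right 0. - (s * L) \<le> 2 * R"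
        by (auto simp: eventually_at_right_field intro!: exI[of _ 1])
      moreover have "((\<lambda>s. - (s * L)) \<longlongrightarrow> - (0 * L)) (at_right 0)" by (intro tendsto_intros)
      ultimately have "- (0 * L) \<le> 2 * R" by (intro tendsto_upperbound) auto
      then show ?thesis by (simp add: R_def)
    qed
    define S where "S = (\<Sum>j\<in>J. u j * f a (\<xi> j) \<eta>)"
    have "0 \<le> Re (c * S)" for c
      using ge[OF BH_scale[OF a, of c]] a by (simp add: scale S_def sum_distrib_left mult_ac)
    from this[of "- cnj S"] have "(Re S)\<^sup>2 + (Im S)\<^sup>2 \<le> 0" by (simp add: power2_eq_square)
    then have "S = 0" by (simp add: sum_power2_le_zero_iff complex_eq_iff)
    then show ?thesis by (simp add: S_def)
  qed
  have f_add: "f a (x + x') y = f a x y + f a x' y" if a: "a \<in> BH" for a x x' y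
    using relation[OF a, of "{0, 1, 2}" "\<lambda>j. if j = 0 then 1 else - 1"
        "\<lambda>j. if j = 0 then x + x' else if j = 1 then x else x'" y]
    by (simp add: scaleC_one complex_vector.scale_minus_left algebra_simps)
  have f_scale: "f a (c *\<^sub>C x) y = c * f a x y" if a: "a \<in> BH" for a c x y
    using relation[OF a, of "{0, 1}" "\<lambda>j. if j = 0 then 1 else - c"
        "\<lambda>j. if j = 0 then c *\<^sub>C x else x" y]
    by (simp add: scaleC_one complex_vector.scale_minus_left)
  have f_zero: "f a 0 y = 0" if "a \<in> BH" for a y using f_scale[OF that, of 0 0 y] by simp
  have f_zero': "f a x 0 = 0" if "a \<in> BH" for a x
    using sym[OF that, of 0 x] f_zero[OF adj_in_BH[OF that], of x] by simp
  have f_bound: "cmod (f a x y) \<le> (norm a + 1) * norm x * norm y" if a: "a \<in> BH" for a x y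
  proof (cases "x = 0 \<or> y = 0")
    case True
    then show ?thesis using f_zero[OF a] f_zero'[OF a] by auto
  next
    case False
    obtain c where c: "cmod c = 1" "Re (c * - f a x y) = cmod (- f a x y)"
      using ex_unimodular_Re by blast
    have "norm (c *\<^sub>C a) \<le> norm a + 1" using norm_scaleC_blinfun_le[of c a] c by simp
    moreover have "0 < norm y / norm x" using False by simp
    ultimately have "0 \<le> norm y / norm x * (norm a + 1) * (norm x)\<^sup>2 - 2 * cmod (f a x y) +
        (norm a + 1) / (norm y / norm x) * (norm y)\<^sup>2"
      using main[OF BH_scale[OF a, of c], of "norm a + 1" "norm y / norm x" "{0}" "\<lambda>_. 1" "\<lambda>_. x" y]
        c(2) by (simp add: scaleC_one scale[OF a])
    moreover have "norm y / norm x * (norm a + 1) * (norm x)\<^sup>2 = (norm a + 1) * norm x * norm y"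
      "(norm a + 1) / (norm y / norm x) * (norm y)\<^sup>2 = (norm a + 1) * norm x * norm y"
      using False by (simp_all add: power2_eq_square)
    ultimately show ?thesis by linarith
  qed
  have "\<exists>T. T \<in> BH \<and> (\<forall>x y. cinner (blinfun_apply T x) y = f a x y)" if a: "a \<in> BH" for a
  proof -
    have "\<exists>T\<in>BH. \<forall>x y. cinner (blinfun_apply T x) y = f a x y"
    proof (rule sesquilinear_form_operator[where K = "norm a + 1"])
      have swap: "f a x y = cnj (f (adj a) y x)" for x y
        using sym[OF a, of y x] by simp
      show "f a x (y + y') = f a x y + f a x y'" for x y y'
        unfolding swap[of x] by (simp add: f_add adj_in_BH[OF a])
      show "f a x (c *\<^sub>C y) = cnj c * f a x y" for c x y
        unfolding swap[of x] by (simp add: f_scale adj_in_BH[OF a])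
    qed (simp_all add: f_add f_scale f_bound a)
    then show ?thesis by blast
  qed
  then obtain \<phi> where \<phi>: "\<And>a. a \<in> BH \<Longrightarrow> \<phi> a \<in> BH"
    and \<phi>f: "\<And>a x y. a \<in> BH \<Longrightarrow> cinner (blinfun_apply (\<phi> a) x) y = f a x y" by metis
  have "ucp \<phi>"
    unfolding ucp_def
  proof (intro conjI ballI allI impI)
    show "\<phi> (a + b) = \<phi> a + \<phi> b" if "a \<in> BH" "b \<in> BH" for a b
      by (intro blinfun_eqI cinner_eqI) (simp add: that \<phi>f add BH_add blinfun.add_left cinner_linear)
    show "\<phi> (c *\<^sub>C a) = c *\<^sub>C \<phi> a" if "a \<in> BH" for c a
      by (intro blinfun_eqI cinner_eqI) (simp add: that \<phi>f scale BH_scale cinner_linear)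
    show "\<phi> id_blinfun = id_blinfun"
      by (intro blinfun_eqI cinner_eqI) (simp add: \<phi>f BH_id unit)
  next
    fix n :: nat and v :: "nat \<Rightarrow> nat \<Rightarrow> 'a \<Rightarrow>\<^sub>L 'a"
    assume "\<forall>i<n. \<forall>j<n. v i j \<in> BH" "accretive {..<n} v"
    then show "accretive {..<n} (\<lambda>i j. \<phi> (v i j))"
      unfolding accretive_def[of _ "\<lambda>i j. \<phi> (v i j)"] quad_def
      using pos[of n v] by (simp add: \<phi>f)
  qed (rule \<phi>)
  then show thesis using \<phi>f by (rule that)
qed

text \<open>Arveson's extension theorem for the map \<open>x + y \<mapsto> x\<close> from \<open>X + I\<close> to \<open>B(H)\<close>. A map into \<open>B(H)\<close> is a functional on
  matrices indexed by vectors of \<open>H\<close>. Such a matrix \<open>v\<close> enters only through the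
  real function \<open>\<zeta> \<mapsto> Re \<Sum> \<langle>v\<^sub>\<eta>\<^sub>\<xi> \<zeta>(\<xi>), \<zeta>(\<eta>)\<rangle>\<close> of families \<open>\<zeta>\<close> of vectors indexed by \<open>H\<close>; it is accretive iff
  this function is nonnegative, and evaluation of the function at \<open>\<zeta> = id\<close> corresponds to the identity map. So
  the pairs consisting of the function of a matrix over \<open>X + I\<close> and the value at \<open>id\<close> of its part over \<open>X\<close> are the graph
  of a positive functional, and \<open>positive_extension\<close> applies: the scalar matrices in \<open>X\<close>
  majorise everything. The complex forms are recovered from the real functional \<open>F\<close> by \<open>F(a) - \<i> F(\<i> a)\<close>.\<close>

lemma ucp_extension:
  assumes X: "unital_operator_space X" and I: "complex_vector.subspace I" "I \<subseteq> BH"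
    and B: "accretive_boundary X I"
  obtains \<phi> where "ucp \<phi>" "\<And>x. x \<in> X \<Longrightarrow> \<phi> x = x" "\<And>y. y \<in> I \<Longrightarrow> \<phi> y = 0"
proof -
  have XB: "X \<subseteq> BH" and Xs: "complex_vector.subspace X" and X1: "id_blinfun \<in> X"
    using X by (auto simp: unital_operator_space_def)
  have X0: "0 \<in> X" and I0: "0 \<in> I" using Xs I by (auto simp: complex_vector.subspace_0)
  have Xr: "r *\<^sub>R x \<in> X" if "x \<in> X" for r x
    using that Xs by (simp add: scaleR_scaleC complex_vector.subspace_scale)
  have Ir: "r *\<^sub>R x \<in> I" if "x \<in> I" for r x
    using that I by (simp add: scaleR_scaleC complex_vector.subspace_scale)
  \<comment> \<open>the function of the matrix whose only nonzero entry is \<open>a\<close>, at the place \<open>(\<eta>, \<xi>)\<close>\<close>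
  define E where "E a \<xi> \<eta> \<zeta> = Re (cinner (blinfun_apply a (\<zeta> \<xi>)) (\<zeta> \<eta>))"
    for a and \<xi> \<eta> :: 'a and \<zeta> :: "'a \<Rightarrow> 'a"
  define adm where "adm A x y \<longleftrightarrow> finite A \<and> (\<forall>i j. x i j \<in> X \<and> y i j \<in> I \<and>
      (i \<notin> A \<or> j \<notin> A \<longrightarrow> x i j = 0 \<and> y i j = 0))"
    for A :: "'a set" and x y :: "'a \<Rightarrow> 'a \<Rightarrow> 'a \<Rightarrow>\<^sub>L 'a"
  define M where "M = {(quad A (\<lambda>i j. x i j + y i j), quad A x id) | A x y. adm A x y}"
  have MI: "(u, r) \<in> M" if "adm A x y" "u = quad A (\<lambda>i j. x i j + y i j)" "r = quad A x id" for A x y u r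
    using that unfolding M_def by blast
  have ME: "\<exists>A x y. adm A x y \<and> u = quad A (\<lambda>i j. x i j + y i j) \<and> r = quad A x id"
    if "(u, r) \<in> M" for u r using that unfolding M_def by blast
  have M_add: "(\<lambda>z. u z + v z, r + s) \<in> M" if uv: "(u, r) \<in> M" "(v, s) \<in> M" for u v r s
  proof -
    obtain A x y where a: "adm A x y" "u = quad A (\<lambda>i j. x i j + y i j)" "r = quad A x id"
      using ME[OF uv(1)] by blast
    obtain A' x' y' where b: "adm A' x' y'" "v = quad A' (\<lambda>i j. x' i j + y' i j)" "s = quad A' x' id"
      using ME[OF uv(2)] by blast
    have fin: "finite (A \<union> A')" using a(1) b(1) by (auto simp: adm_def)
    have u: "u = quad (A \<union> A') (\<lambda>i j. x i j + y i j)" "r = quad (A \<union> A') x id"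
      unfolding a using a(1) fin by (auto simp: adm_def fun_eq_iff intro!: quad_superset[symmetric])
    have v: "v = quad (A \<union> A') (\<lambda>i j. x' i j + y' i j)" "s = quad (A \<union> A') x' id"
      unfolding b using b(1) fin by (auto simp: adm_def fun_eq_iff intro!: quad_superset[symmetric])
    show ?thesis
    proof (rule MI)
      show "adm (A \<union> A') (\<lambda>i j. x i j + x' i j) (\<lambda>i j. y i j + y' i j)"
        using a(1) b(1) Xs I(1) by (auto simp: adm_def intro: complex_vector.subspace_add)
      show "r + s = quad (A \<union> A') (\<lambda>i j. x i j + x' i j) id"
        by (simp add: u v quad_add)
      have "(\<lambda>i j. (x i j + x' i j) + (y i j + y' i j)) = (\<lambda>i j. (x i j + y i j) + (x' i j + y' i j))"
        by (simp add: algebra_simps)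
      then show "(\<lambda>z. u z + v z) = quad (A \<union> A') (\<lambda>i j. (x i j + x' i j) + (y i j + y' i j))"
        by (simp only: u v quad_add fun_eq_iff) simp
    qed
  qed
  have quad_scale: "quad A (\<lambda>i j. c *\<^sub>R v i j) \<zeta> = c * quad A v \<zeta>" for A :: "'a set" and c v \<zeta>
    by (simp add: quad_def blinfun.scaleR_left cinner_linear sum_distrib_left)
  have M_scale: "(\<lambda>z. c * u z, c * r) \<in> M" if u: "(u, r) \<in> M" for u r c
  proof -
    obtain A x y where a: "adm A x y" "u = quad A (\<lambda>i j. x i j + y i j)" "r = quad A x id"
      using ME[OF u] by blast
    have "adm A (\<lambda>i j. c *\<^sub>R x i j) (\<lambda>i j. c *\<^sub>R y i j)"
      using a(1) by (auto simp: adm_def intro: Xr Ir)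
    then show ?thesis
      by (rule MI) (auto simp: a quad_scale scaleR_add_right[symmetric] simp del: scaleR_add_right)
  qed
  have M_pos: "0 \<le> r" if u: "(u, r) \<in> M" "\<And>z. 0 \<le> u z" for u r
  proof -
    obtain A x y where a: "adm A x y" "u = quad A (\<lambda>i j. x i j + y i j)" "r = quad A x id"
      using ME[OF u(1)] by blast
    have "accretive A x"
    proof (rule accretive_boundaryD[OF B])
      show "accretive A (\<lambda>i j. x i j + y i j)" using u(2) by (simp add: a accretive_def)
    qed (use a(1) in \<open>auto simp: adm_def\<close>)
    then show ?thesis by (simp add: a accretive_def)
  qed
  have M_single: "(E (x + y) \<xi> \<eta>, Re (cinner (blinfun_apply x \<xi>) \<eta>)) \<in> M"
    if xy: "x \<in> X" "y \<in> I" for x y \<xi> \<eta>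
  proof (rule MI)
    let ?s = "\<lambda>a p q. if p = \<eta> \<and> q = \<xi> then a else 0 :: 'a \<Rightarrow>\<^sub>L 'a"
    show "adm {\<eta>, \<xi>} (?s x) (?s y)" using xy X0 I0 by (auto simp: adm_def)
    have "(\<lambda>i j. ?s x i j + ?s y i j) = ?s (x + y)" by (auto simp: fun_eq_iff)
    then show "E (x + y) \<xi> \<eta> = quad {\<eta>, \<xi>} (\<lambda>i j. ?s x i j + ?s y i j)"
      by (simp add: quad_single E_def fun_eq_iff)
    show "Re (cinner (blinfun_apply x \<xi>) \<eta>) = quad {\<eta>, \<xi>} (?s x) id" by (simp add: quad_single)
  qed
  have M_zero: "(\<lambda>z. 0, 0) \<in> M"
    using M_single[OF X0 I0, of 0 0] by (simp add: E_def[abs_def])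
  have ED: "E a \<xi> \<eta> \<in> majorised M" for a \<xi> \<eta>
  proof -
    have "\<bar>E a \<xi> \<eta> z\<bar> \<le> E (norm a *\<^sub>R id_blinfun + 0) \<xi> \<xi> z + E (norm a *\<^sub>R id_blinfun + 0) \<eta> \<eta> z" for z
    proof -
      have "\<bar>E a \<xi> \<eta> z\<bar> \<le> norm (blinfun_apply a (z \<xi>)) * norm (z \<eta>)"
        unfolding E_def by (rule order_trans[OF abs_Re_le_cmod norm_cinner_le])
      also have "\<dots> \<le> norm a * norm (z \<xi>) * norm (z \<eta>)"
        by (intro mult_right_mono norm_blinfun) simp
      also have "\<dots> \<le> norm a * ((norm (z \<xi>))\<^sup>2 + (norm (z \<eta>))\<^sup>2)"
        unfolding mult.assoc
      proof (rule mult_left_mono)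
        have "0 \<le> norm (z \<xi>) * norm (z \<eta>)" by simp
        then show "norm (z \<xi>) * norm (z \<eta>) \<le> (norm (z \<xi>))\<^sup>2 + (norm (z \<eta>))\<^sup>2"
          using sum_squares_bound[of "norm (z \<xi>)" "norm (z \<eta>)"] by linarith
      qed simp
      also have "\<dots> = E (norm a *\<^sub>R id_blinfun + 0) \<xi> \<xi> z + E (norm a *\<^sub>R id_blinfun + 0) \<eta> \<eta> z"
        by (simp add: E_def blinfun.scaleR_left cinner_linear cinner_self algebra_simps)
      finally show ?thesis .
    qed
    then show ?thesis
      unfolding majorised_def using M_add[OF M_single M_single] Xr[OF X1] I0 by blast
  qed
  obtain F where F_add: "\<And>g h. g \<in> majorised M \<Longrightarrow> h \<in> majorised M \<Longrightarrow> F (\<lambda>z. g z + h z) = F g + F h"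
    and F_scale: "\<And>g c. g \<in> majorised M \<Longrightarrow> F (\<lambda>z. c * g z) = c * F g"
    and F_pos: "\<And>g. g \<in> majorised M \<Longrightarrow> (\<And>z. 0 \<le> g z) \<Longrightarrow> 0 \<le> F g"
    and F_M: "\<And>u r. (u, r) \<in> M \<Longrightarrow> u \<in> majorised M \<Longrightarrow> F u = r"
    using positive_extension[of M] M_zero M_add M_scale M_pos by blast
  have zero_maj: "(\<lambda>z. 0) \<in> majorised M" unfolding majorised_def using M_zero by auto
  have sum_maj: "(\<lambda>z. \<Sum>i\<in>S. g i z) \<in> majorised M \<and> F (\<lambda>z. \<Sum>i\<in>S. g i z) = (\<Sum>i\<in>S. F (g i))"
    if "\<And>i. i \<in> S \<Longrightarrow> g i \<in> majorised M" for S :: "nat set" and g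
    using that
  proof (induction S rule: infinite_finite_induct)
    case (insert i S)
    then show ?case using F_add[of "g i" "\<lambda>z. \<Sum>i\<in>S. g i z"] M_add by (auto intro: majorised_add)
  qed (use zero_maj F_M[OF M_zero zero_maj] in auto)
  define f where "f a \<xi> \<eta> = Complex (F (E a \<xi> \<eta>)) (- F (E (\<i> *\<^sub>C a) \<xi> \<eta>))" for a \<xi> \<eta>
  have FE_add: "F (E (a + b) \<xi> \<eta>) = F (E a \<xi> \<eta>) + F (E b \<xi> \<eta>)" for a b \<xi> \<eta>
  proof -
    have "E (a + b) \<xi> \<eta> = (\<lambda>z. E a \<xi> \<eta> z + E b \<xi> \<eta> z)"
      by (simp add: E_def fun_eq_iff blinfun.add_left cinner_linear)
    then show ?thesis using F_add[OF ED ED] by simp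
  qed
  have FE_scale: "F (E (c *\<^sub>C a) \<xi> \<eta>) = Re c * F (E a \<xi> \<eta>) + Im c * F (E (\<i> *\<^sub>C a) \<xi> \<eta>)" for c a \<xi> \<eta>
  proof -
    have "E (c *\<^sub>C a) \<xi> \<eta> = (\<lambda>z. Re c * E a \<xi> \<eta> z + Im c * E (\<i> *\<^sub>C a) \<xi> \<eta> z)"
      by (simp add: E_def fun_eq_iff cinner_linear)
    moreover have "(\<lambda>z. r * E b \<xi> \<eta> z) \<in> majorised M" for r b
      using M_scale ED by (rule majorised_scale)
    ultimately show ?thesis by (simp add: F_add F_scale ED)
  qed
  have f_ext: "f (x + y) \<xi> \<eta> = cinner (blinfun_apply x \<xi>) \<eta>" if xy: "x \<in> X" "y \<in> I" for x y \<xi> \<eta>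
  proof -
    have "F (E (\<i> *\<^sub>C x + \<i> *\<^sub>C y) \<xi> \<eta>) = Re (cinner (blinfun_apply (\<i> *\<^sub>C x) \<xi>) \<eta>)"
      using xy Xs I by (intro F_M M_single ED) (auto intro: complex_vector.subspace_scale)
    moreover have "F (E (x + y) \<xi> \<eta>) = Re (cinner (blinfun_apply x \<xi>) \<eta>)"
      using xy by (intro F_M M_single ED)
    ultimately show ?thesis by (simp add: f_def scaleC_add_right cinner_linear complex_eq_iff)
  qed
  obtain \<phi> where \<phi>: "ucp \<phi>" "\<And>a \<xi> \<eta>. a \<in> BH \<Longrightarrow> cinner (blinfun_apply (\<phi> a) \<xi>) \<eta> = f a \<xi> \<eta>"
  proof (rule ucp_of_forms[of f])
    show "f (a + b) \<xi> \<eta> = f a \<xi> \<eta> + f b \<xi> \<eta>" for a b \<xi> \<eta>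
      by (simp add: f_def FE_add scaleC_add_right complex_eq_iff)
    show "f (c *\<^sub>C a) \<xi> \<eta> = c * f a \<xi> \<eta>" for c a \<xi> \<eta>
      by (simp add: f_def FE_scale[of c] FE_scale[of "\<i> * c"] scaleC_scaleC complex_eq_iff)
    show "f id_blinfun \<xi> \<eta> = cinner \<xi> \<eta>" for \<xi> \<eta> using f_ext[OF X1 I0] by simp
    fix n :: nat and v :: "nat \<Rightarrow> nat \<Rightarrow> 'a \<Rightarrow>\<^sub>L 'a" and \<xi> :: "nat \<Rightarrow> 'a"
    assume acc: "accretive {..<n} v"
    have "0 \<le> F (\<lambda>z. \<Sum>i<n. \<Sum>j<n. E (v i j) (\<xi> j) (\<xi> i) z)"
    proof (rule F_pos)
      show "(\<lambda>z. \<Sum>i<n. \<Sum>j<n. E (v i j) (\<xi> j) (\<xi> i) z) \<in> majorised M"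
        by (intro sum_maj[THEN conjunct1] ED)
      fix z
      have "(\<Sum>i<n. \<Sum>j<n. E (v i j) (\<xi> j) (\<xi> i) z) = quad {..<n} v (z \<circ> \<xi>)"
        by (simp add: quad_def E_def)
      then show "0 \<le> (\<Sum>i<n. \<Sum>j<n. E (v i j) (\<xi> j) (\<xi> i) z)" using acc by (simp add: accretive_def)
    qed
    also have "\<dots> = (\<Sum>i<n. \<Sum>j<n. F (E (v i j) (\<xi> j) (\<xi> i)))"
      using sum_maj ED by (subst sum_maj[THEN conjunct2]) auto
    also have "\<dots> = Re (\<Sum>i<n. \<Sum>j<n. f (v i j) (\<xi> j) (\<xi> i))" by (simp add: f_def)
    finally show "0 \<le> Re (\<Sum>i<n. \<Sum>j<n. f (v i j) (\<xi> j) (\<xi> i))" .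
  qed blast
  show thesis
  proof (rule that[OF \<phi>(1)])
    fix x assume "x \<in> X"
    then show "\<phi> x = x"
      using \<phi>(2)[of x] f_ext[of x 0] XB I0 by (intro blinfun_eqI cinner_eqI) auto
  next
    fix y assume "y \<in> I"
    then show "\<phi> y = 0"
      using \<phi>(2)[of y] f_ext[of 0 y] I(2) X0 by (intro blinfun_eqI cinner_eqI) auto
  qed
qed

section \<open>The Schwarz inequality and the Choi--Effros product\<close>

lemma
  assumes "ucp \<phi>"
  shows ucp_BH: "a \<in> BH \<Longrightarrow> \<phi> a \<in> BH"
    and ucp_add: "a \<in> BH \<Longrightarrow> b \<in> BH \<Longrightarrow> \<phi> (a + b) = \<phi> a + \<phi> b"
    and ucp_scale: "a \<in> BH \<Longrightarrow> \<phi> (c *\<^sub>C a) = c *\<^sub>C \<phi> a"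
    and ucp_unit: "\<phi> id_blinfun = id_blinfun"
  using assms by (auto simp: ucp_def)

lemma ucp_zero: "ucp \<phi> \<Longrightarrow> \<phi> 0 = 0"
  using ucp_scale[of \<phi> 0 0] by (simp add: BH_zero)

lemma ucp_diff:
  assumes "ucp \<phi>" "a \<in> BH" "b \<in> BH"
  shows "\<phi> (a - b) = \<phi> a - \<phi> b"
  using ucp_add[OF assms(1) BH_diff[OF assms(2,3)] assms(3)] by simp

lemma ucp_scaleR: "ucp \<phi> \<Longrightarrow> a \<in> BH \<Longrightarrow> \<phi> (r *\<^sub>R a) = r *\<^sub>R \<phi> a"
  by (simp add: scaleR_scaleC ucp_scale)

lemma ucp_accretive:
  assumes "ucp \<phi>" and A: "finite A" and v: "\<And>i j. i \<in> A \<Longrightarrow> j \<in> A \<Longrightarrow> v i j \<in> BH"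
    and acc: "accretive A v"
  shows "accretive A (\<lambda>i j. \<phi> (v i j))"
proof -
  obtain h where "bij_betw h {0..<card A} A" using ex_bij_betw_nat_finite[OF A] by blast
  then have h: "bij_betw h {..<card A} A" by (simp add: atLeast0LessThan)
  have "accretive {..<card A} (\<lambda>i j. \<phi> (v (h i) (h j)))"
    using assms(1)[unfolded ucp_def] acc v bij_betwE[OF h] by (simp add: accretive_reindex[OF h])
  then show ?thesis by (simp add: accretive_reindex[OF h])
qed

lemma ucp_compose:
  assumes "ucp \<phi>" "ucp \<psi>" shows "ucp (\<lambda>a. \<phi> (\<psi> a))"
  unfolding ucp_def
  by (auto simp: assms ucp_BH[OF assms(1)] ucp_BH[OF assms(2)] ucp_add[OF assms(1)]
      ucp_add[OF assms(2)] ucp_scale[OF assms(1)] ucp_scale[OF assms(2)] ucp_unit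
      intro!: ucp_accretive[OF assms(1)] ucp_accretive[OF assms(2)])

lemma ucp_funpow: "ucp \<phi> \<Longrightarrow> ucp (\<phi> ^^ n)"
proof (induction n)
  case 0
  then show ?case by (simp add: ucp_def)
next
  case (Suc n)
  then show ?case using ucp_compose[of \<phi> "\<phi> ^^ n"] by (simp add: comp_def)
qed

lemma ucp_positive:
  assumes "ucp \<phi>" "a \<in> BH" "\<And>x. 0 \<le> Re (cinner (blinfun_apply a x) x)"
  shows "0 \<le> Re (cinner (blinfun_apply (\<phi> a) x) x)"
proof -
  have "accretive {()} (\<lambda>_ _. a)" using assms(3) by (simp add: accretive_def quad_def)
  then have "accretive {()} (\<lambda>_ _. \<phi> a)"
    by (intro ucp_accretive[OF assms(1), of _ "\<lambda>_ _. a"] assms(2)) simp_all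
  then have "0 \<le> quad {()} (\<lambda>_ _. \<phi> a) (\<lambda>_. x)" unfolding accretive_def by blast
  then show ?thesis by (simp add: quad_def)
qed

lemma ucp_2positive:
  assumes "ucp \<phi>" "a \<in> BH" "b \<in> BH" "d \<in> BH"
    and pos: "\<And>x y. 0 \<le> Re (cinner (blinfun_apply a x) x) + Re (cinner (blinfun_apply b y) x) +
      Re (cinner (blinfun_apply d y) y)"
  shows "0 \<le> Re (cinner (blinfun_apply (\<phi> a) x) x) + Re (cinner (blinfun_apply (\<phi> b) y) x) +
      Re (cinner (blinfun_apply (\<phi> d) y) y)"
proof -
  define v where "v p q = (if p then (if q then d else 0) else if q then b else a)" for p q
  have "accretive UNIV v"
    using pos by (simp add: accretive_def quad_def UNIV_bool v_def add_ac)
  then have "accretive UNIV (\<lambda>p q. \<phi> (v p q))"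
    by (intro ucp_accretive[OF assms(1), of _ v]) (simp_all add: v_def BH_zero assms(2-4))
  then have "0 \<le> quad UNIV (\<lambda>p q. \<phi> (v p q)) (\<lambda>p. if p then y else x)"
    unfolding accretive_def by blast
  then show ?thesis by (simp add: quad_def UNIV_bool v_def ucp_zero[OF assms(1)] add_ac)
qed

text \<open>The inequality \<open>\<parallel>a\<parallel> \<le> K\<close> is accretivity of \<open>[[K, 2 a], [0, K]]\<close>, which \<open>\<phi>\<close> preserves.\<close>

lemma norm_ucp_le:
  assumes "ucp \<phi>" "a \<in> BH" shows "norm (\<phi> a) \<le> norm a"
proof (cases "a = 0")
  case True
  then show ?thesis by (simp add: ucp_zero assms)
next
  case False
  define K where "K = norm a"
  have K: "0 < K" using False by (simp add: K_def)
  have pos: "0 \<le> Re (cinner (blinfun_apply (\<phi> (K *\<^sub>R id_blinfun)) x) x) +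
      Re (cinner (blinfun_apply (\<phi> (2 *\<^sub>R a)) y) x) +
      Re (cinner (blinfun_apply (\<phi> (K *\<^sub>R id_blinfun)) y) y)" for x y
  proof (rule ucp_2positive[OF assms(1)])
    fix x y :: 'a
    have "- Re (cinner (blinfun_apply a y) x) \<le> norm (blinfun_apply a y) * norm x"
      using Re_cinner_le[of "- blinfun_apply a y" x] by (simp add: cinner_linear)
    also have "\<dots> \<le> K * norm y * norm x"
      unfolding K_def by (intro mult_right_mono norm_blinfun) auto
    finally have "- 2 * Re (cinner (blinfun_apply a y) x) \<le> 2 * (K * norm y * norm x)" by linarith
    moreover have "K * (2 * norm y * norm x) \<le> K * ((norm x)\<^sup>2 + (norm y)\<^sup>2)"
      using K sum_squares_bound[of "norm y" "norm x"] by (intro mult_left_mono) auto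
    ultimately have "0 \<le> K * (norm x)\<^sup>2 + 2 * Re (cinner (blinfun_apply a y) x) + K * (norm y)\<^sup>2"
      unfolding distrib_left by linarith
    then show "0 \<le> Re (cinner (blinfun_apply (K *\<^sub>R id_blinfun) x) x) +
        Re (cinner (blinfun_apply (2 *\<^sub>R a) y) x) + Re (cinner (blinfun_apply (K *\<^sub>R id_blinfun) y) y)"
      by (simp add: blinfun.scaleR_left cinner_linear cinner_self)
  qed (auto intro: BH_scaleR BH_id assms)
  have "norm (blinfun_apply (\<phi> a) y) \<le> K * norm y" for y
  proof -
    let ?w = "blinfun_apply (\<phi> a) y"
    have "0 \<le> (norm ?w)\<^sup>2 / K - 2 * ((norm ?w)\<^sup>2 / K) + K * (norm y)\<^sup>2"
      using K pos[of "(- 1 / K) *\<^sub>R ?w" y]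
      by (simp add: ucp_scaleR[OF assms(1)] BH_id assms(2) ucp_unit[OF assms(1)] blinfun.scaleR_left
          cinner_linear cinner_self power2_eq_square)
    then have "(norm ?w)\<^sup>2 / K \<le> K * (norm y)\<^sup>2" by linarith
    then have "(norm ?w)\<^sup>2 \<le> K * (norm y)\<^sup>2 * K" by (simp only: pos_divide_le_eq[OF K])
    also have "\<dots> = (K * norm y)\<^sup>2" by (simp add: power2_eq_square)
    finally show ?thesis by (rule power2_le_imp_le) (use K in simp)
  qed
  then show ?thesis unfolding K_def by (intro norm_blinfun_bound) auto
qed

lemma continuous_on_ucp: "ucp \<phi> \<Longrightarrow> continuous_on BH \<phi>"
proof (rule lipschitz_on_continuous_on)
  assume \<phi>: "ucp \<phi>"
  show "1-lipschitz_on BH \<phi>"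
    by (rule lipschitz_onI)
      (auto simp: dist_norm ucp_diff[OF \<phi>, symmetric] norm_ucp_le[OF \<phi>] BH_diff)
qed

text \<open>The operator \<open>a - a\<^sup>*\<close> and its negative are both accretive, hence so are their images; the same
  argument for \<open>\<i> a\<close> gives the imaginary part.\<close>

lemma ucp_adj:
  assumes \<phi>: "ucp \<phi>" and a: "a \<in> BH"
  shows "\<phi> (adj a) = adj (\<phi> a)"
proof -
  note cl = adj_in_BH BH_scale BH_diff ucp_BH[OF \<phi>]
  have *: "Re (cinner (blinfun_apply (\<phi> (adj b)) x) x) = Re (cinner (blinfun_apply (\<phi> b) x) x)"
    if b: "b \<in> BH" for b x
  proof -
    have "Re (cinner (blinfun_apply (adj b) x) x) = Re (cinner (blinfun_apply b x) x)" for x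
      by (simp add: cinner_adj_left[OF b] Re_cinner_commute)
    then have "0 \<le> Re (cinner (blinfun_apply (\<phi> (b - adj b)) x) x)"
      "0 \<le> Re (cinner (blinfun_apply (\<phi> (adj b - b)) x) x)"
      by (auto intro!: ucp_positive[OF \<phi>] cl b simp: blinfun.diff_left cinner_linear)
    then show ?thesis by (simp add: ucp_diff[OF \<phi>] b cl blinfun.diff_left cinner_linear)
  qed
  have "\<phi> (adj a) - adj (\<phi> a) = 0"
  proof (rule BH_eq_0I)
    fix x
    have "cinner (blinfun_apply (\<phi> (adj a)) x) x = cnj (cinner (blinfun_apply (\<phi> a) x) x)"
    proof (rule complex_eqI)
      show "Im (cinner (blinfun_apply (\<phi> (adj a)) x) x) = Im (cnj (cinner (blinfun_apply (\<phi> a) x) x))"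
        using *[OF BH_scale[OF a, of "\<i>"], of x] ucp_scale[OF \<phi> adj_in_BH[OF a], of "cnj \<i>"]
        by (simp add: adj_scaleC a ucp_scale[OF \<phi>] cinner_linear blinfun.minus_left)
    qed (simp add: *[OF a])
    also have "\<dots> = cinner (blinfun_apply (adj (\<phi> a)) x) x"
      by (simp add: cinner_adj_left cl a cinner_commute[of x])
    finally show "cinner (blinfun_apply (\<phi> (adj a) - adj (\<phi> a)) x) x = 0"
      by (simp add: blinfun.diff_left cinner_linear)
  qed (intro cl a)
  then show ?thesis by simp
qed

text \<open>The Kadison--Schwarz inequality. The matrix \<open>[[1, 2 b], [0, b\<^sup>* b]]\<close> is accretive, its form being
  \<open>\<parallel>x + b y\<parallel>\<^sup>2\<close>; its image is evaluated at \<open>x = - \<phi>(b) y\<close>.\<close>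

lemma ucp_schwarz:
  assumes \<phi>: "ucp \<phi>" and b: "b \<in> BH"
  shows "(norm (blinfun_apply (\<phi> b) y))\<^sup>2 \<le> Re (cinner (blinfun_apply (\<phi> (adj b o\<^sub>L b)) y) y)"
proof -
  have "0 \<le> Re (cinner (blinfun_apply (\<phi> id_blinfun) x) x) +
      Re (cinner (blinfun_apply (\<phi> (2 *\<^sub>R b)) y) x) +
      Re (cinner (blinfun_apply (\<phi> (adj b o\<^sub>L b)) y) y)" for x
  proof (rule ucp_2positive[OF \<phi>])
    fix x y :: 'a
    have "0 \<le> (norm (x + blinfun_apply b y))\<^sup>2" by simp
    then show "0 \<le> Re (cinner (blinfun_apply id_blinfun x) x) +
        Re (cinner (blinfun_apply (2 *\<^sub>R b) y) x) + Re (cinner (blinfun_apply (adj b o\<^sub>L b) y) y)"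
      by (simp add: norm_add_square blinfun.scaleR_left cinner_linear cinner_adj_left[OF b] cinner_self
          Re_cinner_commute[of x])
  qed (auto intro: BH_scaleR BH_id b BH_compose adj_in_BH)
  from this[of "- blinfun_apply (\<phi> b) y"] show ?thesis
    by (simp add: ucp_unit[OF \<phi>] ucp_scaleR[OF \<phi>] b blinfun.scaleR_left cinner_linear cinner_self)
qed

lemma eq_0_if_scaled_Re_bounded_below:
  assumes "\<And>s. 0 \<le> Re (cnj s * z) + c" shows "z = 0"
proof (rule ccontr)
  assume z: "z \<noteq> 0"
  define t where "t = (c + 1) / (cmod z)\<^sup>2"
  have "Re (cnj (of_real (- t) * z) * z) = - t * (cmod z)\<^sup>2"
    by (simp add: cmod_power2 power2_eq_square[of "Re z"] power2_eq_square[of "Im z"] algebra_simps)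
  also have "\<dots> = - (c + 1)" using z by (simp add: t_def)
  finally show False using assms[of "of_real (- t) * z"] by simp
qed

lemma adj_compose_expand:
  assumes "e \<in> BH" "a \<in> BH"
  shows "adj (s *\<^sub>C e + a) o\<^sub>L (s *\<^sub>C e + a) =
    (of_real ((cmod s)\<^sup>2) *\<^sub>C (adj e o\<^sub>L e) + (cnj s *\<^sub>C (adj e o\<^sub>L a) + s *\<^sub>C (adj a o\<^sub>L e)) + (adj a o\<^sub>L a))"
proof -
  have "cnj s * s = of_real ((cmod s)\<^sup>2)" by (metis complex_norm_square mult.commute)
  then show ?thesis
    by (intro blinfun_eqI)
      (simp add: assms adj_add adj_scaleC BH_scale blinfun.add_left blinfun.add_right
        BH_scaleC[OF adj_in_BH[OF assms(1)]] BH_scaleC[OF adj_in_BH[OF assms(2)]]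
        scaleC_add_right scaleC_scaleC add_ac)
qed

text \<open>For idempotent \<open>\<phi>\<close> the kernel is a module over the range; this is the heart of the Choi--Effros
  theorem. Put \<open>e = x\<^sup>*\<close> and apply the Schwarz inequality to \<open>b = s e + a\<close>, whose image is \<open>s e\<close>. In
  \<open>\<phi>(b\<^sup>* b) - \<bar>s\<bar>\<^sup>2 e\<^sup>* e \<ge> 0\<close> a second application of \<open>\<phi>\<close> removes the terms quadratic in \<open>s\<close>. What remains is
  affine in \<open>s\<close> and bounded below, so its linear part \<open>2 Re (cnj s \<phi>(x a))\<close> vanishes.\<close>

lemma ucp_kernel_module:
  assumes \<phi>: "ucp \<phi>" and idem: "\<And>a. a \<in> BH \<Longrightarrow> \<phi> (\<phi> a) = \<phi> a"
    and x: "x \<in> BH" "\<phi> x = x" and a: "a \<in> BH" "\<phi> a = 0"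
  shows "\<phi> (x o\<^sub>L a) = 0"
proof -
  define e where "e = adj x"
  have e: "e \<in> BH" "\<phi> e = e" "adj e = x"
    using x by (auto simp: e_def adj_in_BH ucp_adj[OF \<phi>] adj_adj)
  note cl = adj_in_BH BH_scale BH_diff BH_add BH_compose ucp_BH[OF \<phi>]
  note lin = ucp_add[OF \<phi>] ucp_scale[OF \<phi>] ucp_diff[OF \<phi>]
  have adjxa: "adj a o\<^sub>L e = adj (x o\<^sub>L a)" by (simp add: e_def adj_compose x a)
  have "cinner (blinfun_apply (\<phi> (x o\<^sub>L a)) y) y = 0" for y
  proof (rule eq_0_if_scaled_Re_bounded_below)
    fix s
    define b where "b = s *\<^sub>C e + a"
    define m where "m = of_real ((cmod s)\<^sup>2) *\<^sub>C (x o\<^sub>L e)"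
    define p where "p = cnj s *\<^sub>C (x o\<^sub>L a) + s *\<^sub>C (adj a o\<^sub>L e)"
    have B: "b \<in> BH" "m \<in> BH" "p \<in> BH" "adj a o\<^sub>L a \<in> BH"
      unfolding b_def m_def p_def using e(1) x(1) a(1) by (auto intro!: cl)
    have bb: "adj b o\<^sub>L b = (m + p) + (adj a o\<^sub>L a)"
      unfolding b_def m_def p_def adj_compose_expand[OF e(1) a(1)] e(3) by simp
    have \<phi>b: "\<phi> b = s *\<^sub>C e" unfolding b_def using e a by (simp add: lin cl)
    have "0 \<le> Re (cinner (blinfun_apply (\<phi> (adj b o\<^sub>L b) - m) y) y)" for y
    proof -
      have "Re (cinner (blinfun_apply m y) y) = (norm (blinfun_apply (\<phi> b) y))\<^sup>2"
      proof -
        have "cinner (blinfun_apply x (blinfun_apply e y)) y = of_real ((norm (blinfun_apply e y))\<^sup>2)"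
          using cinner_adj_left[OF e(1)] by (simp add: e(3) cinner_self)
        then show ?thesis
          by (simp add: m_def \<phi>b cinner_linear norm_scaleC power_mult_distrib
              flip: of_real_power of_real_mult)
      qed
      then show ?thesis using ucp_schwarz[OF \<phi> B(1), of y] by (simp add: blinfun.diff_left cinner_linear)
    qed
    then have "0 \<le> Re (cinner (blinfun_apply (\<phi> (\<phi> (adj b o\<^sub>L b) - m)) y) y)"
      using B by (intro ucp_positive[OF \<phi>]) (auto intro!: cl)
    also have "\<phi> (\<phi> (adj b o\<^sub>L b) - m) = \<phi> p + \<phi> (adj a o\<^sub>L a)"
      using B by (simp add: bb lin cl idem)
    also have "\<phi> p = cnj s *\<^sub>C \<phi> (x o\<^sub>L a) + s *\<^sub>C adj (\<phi> (x o\<^sub>L a))"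
      unfolding p_def adjxa using x a by (simp add: lin cl ucp_adj[OF \<phi>])
    finally show "0 \<le> Re (cnj s * cinner (blinfun_apply (\<phi> (x o\<^sub>L a)) y) y) +
        Re (cinner (blinfun_apply (\<phi> (adj a o\<^sub>L a)) y) y) / 2"
      using x(1) a(1)
      by (simp add: blinfun.add_left cinner_linear cinner_adj_left cl
          cinner_commute[of y "blinfun_apply (\<phi> (x o\<^sub>L a)) y"] algebra_simps)
  qed
  then show ?thesis using x(1) a(1) by (intro BH_eq_0I) (auto intro!: cl)
qed

text \<open>The Choi--Effros identity \<open>\<phi>(x a) = \<phi>(x \<phi>(a))\<close>: the range of \<open>\<phi>\<close> is an algebra under
  \<open>x \<circ> y = \<phi>(x y)\<close>.\<close>

lemma ucp_module:
  assumes \<phi>: "ucp \<phi>" and idem: "\<And>a. a \<in> BH \<Longrightarrow> \<phi> (\<phi> a) = \<phi> a"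
    and x: "x \<in> BH" "\<phi> x = x" and a: "a \<in> BH"
  shows "\<phi> (x o\<^sub>L a) = \<phi> (x o\<^sub>L \<phi> a)"
proof -
  have "\<phi> (x o\<^sub>L (a - \<phi> a)) = 0"
  proof (rule ucp_kernel_module[OF \<phi> idem x])
    show "a - \<phi> a \<in> BH" by (intro BH_diff ucp_BH[OF \<phi>] a)
    show "\<phi> (a - \<phi> a) = 0" by (simp add: ucp_diff[OF \<phi>] ucp_BH[OF \<phi>] a idem)
  qed
  moreover have "x o\<^sub>L (a - \<phi> a) = (x o\<^sub>L a) - (x o\<^sub>L \<phi> a)"
    by (intro blinfun_eqI) (simp add: blinfun.diff_left blinfun.diff_right)
  ultimately show ?thesis
    by (simp add: ucp_diff[OF \<phi>] ucp_BH[OF \<phi>] BH_compose x(1) a)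
qed

lemma selfadjoint_eq_0I:
  assumes a: "a \<in> BH" "adj a = a" and "\<And>x. Re (cinner (blinfun_apply a x) x) = 0"
  shows "a = 0"
proof (rule BH_eq_0I[OF a(1)])
  fix x
  have "cinner (blinfun_apply a x) x = cnj (cinner (blinfun_apply a x) x)"
    using cinner_adj[OF a(1), of x x] by (simp add: a(2) cinner_commute[of x])
  then have "Im (cinner (blinfun_apply a x) x) = 0" by (simp add: complex_eq_iff)
  then show "cinner (blinfun_apply a x) x = 0" using assms(3)[of x] by (simp add: complex_eq_iff)
qed

text \<open>The Choi--Effros product depends only on the range, not on the projection onto it. For \<open>b\<close> in the range,
  applying \<open>\<gamma>\<close> to \<open>\<phi>(b\<^sup>* b) \<ge> b\<^sup>* b\<close> gives \<open>\<phi>(b\<^sup>* b) \<ge> \<gamma>(b\<^sup>* b)\<close>; by symmetry equality holds. The general case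
  follows by polarisation, with \<open>b = s x\<^sup>* + e\<close>.\<close>

lemma ucp_product_unique:
  assumes \<phi>: "ucp \<phi>" and \<gamma>: "ucp \<gamma>"
    and \<phi>\<gamma>: "\<And>a. a \<in> BH \<Longrightarrow> \<phi> (\<gamma> a) = \<gamma> a" and \<gamma>\<phi>: "\<And>a. a \<in> BH \<Longrightarrow> \<gamma> (\<phi> a) = \<phi> a"
    and x: "x \<in> BH" "\<phi> x = x" and e: "e \<in> BH" "\<phi> e = e"
  shows "\<phi> (x o\<^sub>L e) = \<gamma> (x o\<^sub>L e)"
proof -
  note cl = adj_in_BH BH_scale BH_diff BH_add BH_compose ucp_BH[OF \<phi>] ucp_BH[OF \<gamma>]
  note lin = ucp_add[OF \<phi>] ucp_scale[OF \<phi>] ucp_diff[OF \<phi>] ucp_add[OF \<gamma>] ucp_scale[OF \<gamma>] ucp_diff[OF \<gamma>]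
  have half: "0 \<le> Re (cinner (blinfun_apply (\<beta> (\<alpha> (adj b o\<^sub>L b)) - \<beta> (adj b o\<^sub>L b)) y) y)"
    if \<alpha>: "ucp \<alpha>" and \<beta>: "ucp \<beta>" and b: "b \<in> BH" "\<alpha> b = b" for \<alpha> \<beta> b y
  proof -
    have BB: "adj b o\<^sub>L b \<in> BH" using b by (intro BH_compose adj_in_BH)
    have "0 \<le> Re (cinner (blinfun_apply (\<alpha> (adj b o\<^sub>L b) - (adj b o\<^sub>L b)) y) y)" for y
      using ucp_schwarz[OF \<alpha> b(1), of y]
      by (simp add: b(2) blinfun.diff_left cinner_linear cinner_adj_left[OF b(1)] cinner_self)
    then have "0 \<le> Re (cinner (blinfun_apply (\<beta> (\<alpha> (adj b o\<^sub>L b) - (adj b o\<^sub>L b))) y) y)"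
      using BB by (intro ucp_positive[OF \<beta>] BH_diff ucp_BH[OF \<alpha>]) auto
    then show ?thesis using BB by (simp add: ucp_diff[OF \<beta>] ucp_BH[OF \<alpha>])
  qed
  have diag: "\<phi> (adj b o\<^sub>L b) = \<gamma> (adj b o\<^sub>L b)" if b: "b \<in> BH" "\<phi> b = b" for b
  proof -
    have BB: "adj b o\<^sub>L b \<in> BH" using b by (intro BH_compose adj_in_BH)
    have "\<gamma> b = b" using \<gamma>\<phi>[OF b(1)] by (simp add: b(2))
    then have "Re (cinner (blinfun_apply (\<phi> (adj b o\<^sub>L b) - \<gamma> (adj b o\<^sub>L b)) y) y) = 0" for y
      using half[OF \<phi> \<gamma> b, of y] half[OF \<gamma> \<phi> b(1), of y] BB
      by (simp add: \<phi>\<gamma> \<gamma>\<phi> blinfun.diff_left cinner_linear)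
    moreover have "adj (adj b o\<^sub>L b) = adj b o\<^sub>L b"
      by (simp add: adj_compose adj_in_BH b adj_adj)
    ultimately have "\<phi> (adj b o\<^sub>L b) - \<gamma> (adj b o\<^sub>L b) = 0"
      using BB by (intro selfadjoint_eq_0I)
        (auto intro!: cl simp: adj_diff cl ucp_adj[OF \<phi>, symmetric] ucp_adj[OF \<gamma>, symmetric])
    then show ?thesis by simp
  qed
  define w where "w = adj x"
  have w: "w \<in> BH" "\<phi> w = w" "adj w = x"
    using x by (auto simp: w_def adj_in_BH ucp_adj[OF \<phi>] adj_adj)
  define P where "P = \<phi> (x o\<^sub>L e) - \<gamma> (x o\<^sub>L e)"
  define Q where "Q = \<phi> (adj e o\<^sub>L w) - \<gamma> (adj e o\<^sub>L w)"
  have PQ: "cnj s *\<^sub>C P + s *\<^sub>C Q = 0" for s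
  proof -
    have "\<phi> (adj (s *\<^sub>C w + e) o\<^sub>L (s *\<^sub>C w + e)) = \<gamma> (adj (s *\<^sub>C w + e) o\<^sub>L (s *\<^sub>C w + e))"
      using w e by (intro diag) (auto intro!: cl simp: lin cl)
    then show ?thesis
      unfolding adj_compose_expand[OF w(1) e(1)] P_def Q_def
      using w e x(1) diag[OF w(1,2)] diag[OF e(1,2)]
      by (simp add: lin cl complex_vector.scale_right_diff_distrib algebra_simps)
  qed
  have "P + Q = 0" using PQ[of 1] by (simp add: scaleC_one)
  then have "Q = - P" by (simp add: eq_neg_iff_add_eq_0 add.commute)
  then have "\<i> *\<^sub>C P + \<i> *\<^sub>C P = 0" using PQ[of "\<i>"]
    by (simp add: eq_neg_iff_add_eq_0[symmetric])
  then have "(\<i> + \<i>) *\<^sub>C P = 0" by (simp only: scaleC_add_left)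
  then have "P = 0" by (simp add: complex_vector.scale_eq_0_iff)
  then show ?thesis by (simp add: P_def)
qed

section \<open>Maximal boundary subsystems\<close>

lemma boundary_subsystem_iff:
  assumes "unital_operator_space X"
  shows "boundary_subsystem X I \<longleftrightarrow> I \<subseteq> BH \<and> complex_vector.subspace I \<and> (\<forall>T\<in>I. adj T \<in> I) \<and>
    accretive_boundary X I"
  using assms completely_isometric_iff_accretive_boundary[of X I]
  unfolding boundary_subsystem_def unital_operator_space_def by blast

lemma boundary_subsystem_kernel:
  assumes X: "unital_operator_space X" and \<phi>: "ucp \<phi>" and fix_X: "\<And>x. x \<in> X \<Longrightarrow> \<phi> x = x"
  shows "boundary_subsystem X {a \<in> BH. \<phi> a = 0}"
  unfolding boundary_subsystem_iff[OF X]
proof (intro conjI ballI)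
  have XB: "X \<subseteq> BH" using X by (simp add: unital_operator_space_def)
  show "complex_vector.subspace {a \<in> BH. \<phi> a = 0}"
    by (rule complex_vector.subspaceI)
      (auto simp: BH_zero BH_add BH_scale ucp_zero[OF \<phi>] ucp_add[OF \<phi>] ucp_scale[OF \<phi>])
  show "adj T \<in> {a \<in> BH. \<phi> a = 0}" if "T \<in> {a \<in> BH. \<phi> a = 0}" for T
    using that by (auto simp: adj_in_BH ucp_adj[OF \<phi>])
  show "accretive_boundary X {a \<in> BH. \<phi> a = 0}"
    unfolding accretive_boundary_def
  proof (intro allI impI)
    fix n :: nat and x y
    assume xy: "\<forall>i<n. \<forall>j<n. x i j \<in> X \<and> y i j \<in> {a \<in> BH. \<phi> a = 0}"
      and acc: "accretive {..<n} (\<lambda>i j. x i j + y i j)"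
    have "accretive {..<n} (\<lambda>i j. \<phi> (x i j + y i j))"
      using xy XB by (intro ucp_accretive[OF \<phi> _ _ acc]) (auto intro!: BH_add)
    then show "accretive {..<n} x"
      using xy subsetD[OF XB] fix_X
      by (subst (asm) accretive_cong[where w = x]) (auto simp: ucp_add[OF \<phi>])
  qed
qed auto

lemma quad_le: "quad A v \<zeta> \<le> (\<Sum>i\<in>A. \<Sum>j\<in>A. norm (v i j) * norm (\<zeta> j) * norm (\<zeta> i))"
  unfolding quad_def Re_sum
  by (intro sum_mono order_trans[OF Re_cinner_le] mult_right_mono norm_blinfun) auto

lemma quad_sum: "quad A (\<lambda>i j. \<Sum>k\<in>S. v k i j) \<zeta> = (\<Sum>k\<in>S. quad A (v k) \<zeta>)"
proof (induction S rule: infinite_finite_induct)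
  case (insert k S)
  then show ?case by (simp add: quad_add)
qed (simp_all add: quad_def)

text \<open>This is what makes maximality produce idempotents. If \<open>x + (a - \<phi>(a))\<close> is accretive, then so is
  \<open>x + (\<phi>\<^sup>k(a) - \<phi>\<^sup>k\<^sup>+\<^sup>1(a))\<close> for every \<open>k\<close>. Summed over \<open>k < m\<close> the second parts telescope to the bounded
  term \<open>a - \<phi>\<^sup>m(a)\<close>, while \<open>x\<close> is multiplied by \<open>m\<close>; so \<open>x\<close> is accretive.\<close>

lemma boundary_subsystem_range:
  assumes X: "unital_operator_space X" and \<phi>: "ucp \<phi>" and fix_X: "\<And>x. x \<in> X \<Longrightarrow> \<phi> x = x"
  shows "boundary_subsystem X {a - \<phi> a | a. a \<in> BH}" (is "boundary_subsystem X ?R")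
  unfolding boundary_subsystem_iff[OF X]
proof (intro conjI ballI)
  have XB: "X \<subseteq> BH" using X by (simp add: unital_operator_space_def)
  show "?R \<subseteq> BH" by (auto intro!: BH_diff ucp_BH[OF \<phi>])
  show "complex_vector.subspace ?R"
  proof (rule complex_vector.subspaceI)
    have "0 = 0 - \<phi> 0" by (simp add: ucp_zero[OF \<phi>])
    then show "0 \<in> ?R" using BH_zero by blast
  next
    fix u v assume "u \<in> ?R" "v \<in> ?R"
    then obtain a b where ab: "u = a - \<phi> a" "a \<in> BH" "v = b - \<phi> b" "b \<in> BH" by blast
    then have "u + v = (a + b) - \<phi> (a + b)" by (simp add: ucp_add[OF \<phi>])
    then show "u + v \<in> ?R" using ab BH_add by blast
  next
    fix c u assume "u \<in> ?R"
    then obtain a where a: "u = a - \<phi> a" "a \<in> BH" by blast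
    then have "c *\<^sub>C u = c *\<^sub>C a - \<phi> (c *\<^sub>C a)"
      by (simp add: ucp_scale[OF \<phi>] complex_vector.scale_right_diff_distrib)
    then show "c *\<^sub>C u \<in> ?R" using a BH_scale by blast
  qed
  show "adj T \<in> ?R" if T: "T \<in> ?R" for T
  proof -
    obtain a where a: "T = a - \<phi> a" "a \<in> BH" using T by blast
    then have "adj T = adj a - \<phi> (adj a)" by (simp add: adj_diff ucp_BH[OF \<phi>] ucp_adj[OF \<phi>])
    then show ?thesis using a adj_in_BH by blast
  qed
  show "accretive_boundary X ?R"
    unfolding accretive_boundary_def
  proof (intro allI impI)
    fix n :: nat and x y
    assume xy: "\<forall>i<n. \<forall>j<n. x i j \<in> X \<and> y i j \<in> ?R"
      and acc: "accretive {..<n} (\<lambda>i j. x i j + y i j)"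
    have "\<exists>a. i < n \<longrightarrow> j < n \<longrightarrow> a \<in> BH \<and> y i j = a - \<phi> a" for i j using xy by blast
    then obtain a where a: "\<And>i j. i < n \<Longrightarrow> j < n \<Longrightarrow> a i j \<in> BH"
      "\<And>i j. i < n \<Longrightarrow> j < n \<Longrightarrow> y i j = a i j - \<phi> (a i j)" by metis
    have x: "x i j \<in> BH" "\<phi> (x i j) = x i j" if "i < n" "j < n" for i j
      using that xy XB fix_X by auto
    have pow_x: "(\<phi> ^^ k) (x i j) = x i j" if "i < n" "j < n" for k i j
      using x[OF that] by (induction k) auto
    note pow = ucp_funpow[OF \<phi>]
    define d where "d k i j = (\<phi> ^^ k) (a i j) - (\<phi> ^^ Suc k) (a i j)" for k i j
    have step: "0 \<le> quad {..<n} x \<zeta> + quad {..<n} (d k) \<zeta>" for k \<zeta>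
    proof -
      have "accretive {..<n} (\<lambda>i j. (\<phi> ^^ k) (x i j + y i j))"
        using a x by (intro ucp_accretive[OF pow _ _ acc]) (auto intro!: BH_add BH_diff ucp_BH[OF \<phi>])
      then have "0 \<le> quad {..<n} (\<lambda>i j. (\<phi> ^^ k) (x i j + y i j)) \<zeta>" by (simp add: accretive_def)
      also have "\<dots> = quad {..<n} (\<lambda>i j. x i j + d k i j) \<zeta>"
        by (rule quad_cong)
          (simp add: a x ucp_add[OF pow] ucp_diff[OF pow] BH_diff ucp_BH[OF \<phi>] pow_x d_def
            funpow_swap1)
      finally show ?thesis by (simp add: quad_add)
    qed
    show "accretive {..<n} x" unfolding accretive_def
    proof
      fix \<zeta> :: "nat \<Rightarrow> 'a"
      define C where "C = (\<Sum>i<n. \<Sum>j<n. 2 * norm (a i j) * norm (\<zeta> j) * norm (\<zeta> i))"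
      have bound: "- C \<le> real m * quad {..<n} x \<zeta>" for m
      proof -
        have "0 \<le> (\<Sum>k<m. quad {..<n} x \<zeta> + quad {..<n} (d k) \<zeta>)" by (intro sum_nonneg step)
        also have "\<dots> = real m * quad {..<n} x \<zeta> + quad {..<n} (\<lambda>i j. \<Sum>k<m. d k i j) \<zeta>"
          by (simp add: sum.distrib quad_sum)
        also have "(\<lambda>i j. \<Sum>k<m. d k i j) = (\<lambda>i j. a i j - (\<phi> ^^ m) (a i j))"
          unfolding d_def
          using sum_lessThan_telescope'[of "\<lambda>k. (\<phi> ^^ k) (a _ _)" m] by (intro ext) simp
        also have "quad {..<n} \<dots> \<zeta> \<le> C"
        proof (rule order_trans[OF quad_le], unfold C_def, intro sum_mono mult_right_mono norm_ge_zero)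
          fix i j assume "i \<in> {..<n}" "j \<in> {..<n}"
          then have "norm ((\<phi> ^^ m) (a i j)) \<le> norm (a i j)" by (intro norm_ucp_le[OF pow] a) auto
          then show "norm (a i j - (\<phi> ^^ m) (a i j)) \<le> 2 * norm (a i j)"
            using norm_triangle_ineq4[of "a i j" "(\<phi> ^^ m) (a i j)"] by linarith
        qed
        finally show ?thesis by linarith
      qed
      show "0 \<le> quad {..<n} x \<zeta>"
      proof (rule ccontr)
        assume "\<not> 0 \<le> quad {..<n} x \<zeta>"
        then have neg: "0 < - quad {..<n} x \<zeta>" by simp
        obtain m where "C < real m * - quad {..<n} x \<zeta>" using reals_Archimedean3[OF neg] by blast
        then show False using bound[of m] by simp
      qed
    qed
  qed
qed

text \<open>Both the kernel of \<open>\<phi>\<close> and the space of all \<open>a - \<phi>(a)\<close> are boundary subsystems that contain \<open>I\<close>, so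
  maximality makes all three equal; that \<open>\<phi>\<close> kills every \<open>a - \<phi>(a)\<close> means that it is idempotent.\<close>

lemma maximal_boundary_ucp:
  assumes X: "unital_operator_space X" and I: "maximal_boundary_subsystem X I"
    and \<phi>: "ucp \<phi>" and fix_X: "\<And>x. x \<in> X \<Longrightarrow> \<phi> x = x" and kill: "\<And>y. y \<in> I \<Longrightarrow> \<phi> y = 0"
  shows "I = {a \<in> BH. \<phi> a = 0}" and "a \<in> BH \<Longrightarrow> \<phi> (\<phi> a) = \<phi> a"
proof -
  have IB: "I \<subseteq> BH" and max: "\<And>I'. boundary_subsystem X I' \<Longrightarrow> I \<subseteq> I' \<Longrightarrow> I' = I"
    using I by (auto simp: maximal_boundary_subsystem_def boundary_subsystem_def)
  show ker: "I = {a \<in> BH. \<phi> a = 0}"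
    using IB kill by (intro max[symmetric] boundary_subsystem_kernel[OF X \<phi> fix_X]) auto
  have "{a - \<phi> a | a. a \<in> BH} = I"
  proof (intro max boundary_subsystem_range[OF X \<phi> fix_X])
    show "I \<subseteq> {a - \<phi> a | a. a \<in> BH}"
    proof
      fix y assume "y \<in> I"
      then have "y = y - \<phi> y" "y \<in> BH" using kill IB by auto
      then show "y \<in> {a - \<phi> a | a. a \<in> BH}" by blast
    qed
  qed
  then have "\<phi> (a - \<phi> a) = 0" if "a \<in> BH" for a using that kill by blast
  then show "a \<in> BH \<Longrightarrow> \<phi> (\<phi> a) = \<phi> a" by (simp add: ucp_diff[OF \<phi>] ucp_BH[OF \<phi>])
qed

lemma cstar_generated_least: "cstar_subalgebra A \<Longrightarrow> X \<subseteq> A \<Longrightarrow> cstar_generated X \<subseteq> A"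
  by (auto simp: cstar_generated_def)

lemma cstar_subalgebra_BH: "cstar_subalgebra BH"
  by (simp add: cstar_subalgebra_def subspace_BH closed_BH BH_compose adj_in_BH)

lemma cstar_subalgebra_generated:
  assumes "X \<subseteq> BH" shows "cstar_subalgebra (cstar_generated X)"
proof -
  let ?F = "{A. cstar_subalgebra A \<and> X \<subseteq> A}"
  have "cstar_generated X \<subseteq> BH" by (rule cstar_generated_least[OF cstar_subalgebra_BH assms])
  moreover have "complex_vector.subspace (\<Inter>?F)"
    by (rule complex_vector.subspace_Inter) (simp add: cstar_subalgebra_def)
  moreover have "closed (\<Inter>?F)" by (rule closed_Inter) (simp add: cstar_subalgebra_def)
  moreover have "S o\<^sub>L T \<in> \<Inter>?F" if "S \<in> \<Inter>?F" "T \<in> \<Inter>?F" for S T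
    using that by (auto simp: cstar_subalgebra_def)
  moreover have "adj T \<in> \<Inter>?F" if "T \<in> \<Inter>?F" for T
    using that by (auto simp: cstar_subalgebra_def)
  ultimately show ?thesis unfolding cstar_subalgebra_def cstar_generated_def by blast
qed

lemma continuous_on_adj: "continuous_on BH adj"
proof (rule lipschitz_on_continuous_on)
  show "1-lipschitz_on BH adj"
    by (rule lipschitz_onI) (auto simp: dist_norm adj_diff[symmetric] norm_adj_le BH_diff)
qed

text \<open>The operators that, together with their adjoints, map \<open>S\<close> into itself by left multiplication form a
  \<open>C\<^sup>*\<close>-algebra.\<close>

lemma cstar_generated_stabiliser:
  fixes X S :: "('a::chilbert_space \<Rightarrow>\<^sub>L 'a) set"
  assumes XB: "X \<subseteq> BH" and S: "complex_vector.subspace S" "closed S"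
    and X: "\<And>x s. x \<in> X \<Longrightarrow> s \<in> S \<Longrightarrow> x o\<^sub>L s \<in> S \<and> adj x o\<^sub>L s \<in> S"
    and c: "c \<in> cstar_generated X" and s: "s \<in> S"
  shows "c o\<^sub>L s \<in> S"
proof -
  define A where "A = {c \<in> BH. \<forall>s\<in>S. c o\<^sub>L s \<in> S \<and> adj c o\<^sub>L s \<in> S}"
  have "cstar_subalgebra A"
    unfolding cstar_subalgebra_def
  proof (intro conjI ballI)
    show "A \<subseteq> BH" by (auto simp: A_def)
    have cadd: "(a + b) o\<^sub>L t = (a o\<^sub>L t) + (b o\<^sub>L t)" for a b t :: "'a \<Rightarrow>\<^sub>L 'a"
      by (rule blinfun_eqI) (simp add: blinfun.add_left)
    have cscale: "(k *\<^sub>C a) o\<^sub>L t = k *\<^sub>C (a o\<^sub>L t)" for k and a t :: "'a \<Rightarrow>\<^sub>L 'a"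
      by (rule blinfun_eqI) simp
    have czero: "0 o\<^sub>L t = 0" for t :: "'a \<Rightarrow>\<^sub>L 'a" by (rule blinfun_eqI) simp
    show "complex_vector.subspace A"
      by (rule complex_vector.subspaceI)
        (auto simp: A_def BH_zero BH_add BH_scale adj_add adj_scaleC cadd cscale czero
          intro: complex_vector.subspace_add[OF S(1)] complex_vector.subspace_scale[OF S(1)]
            complex_vector.subspace_0[OF S(1)])
    have "A = BH \<inter> (\<Inter>s\<in>S. (BH \<inter> (\<lambda>c. c o\<^sub>L s) -` S) \<inter> (BH \<inter> (\<lambda>c. adj c o\<^sub>L s) -` S))"
      by (auto simp: A_def)
    moreover have "continuous_on BH (\<lambda>c. c o\<^sub>L s)" "continuous_on BH (\<lambda>c. adj c o\<^sub>L s)"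
      for s :: "'a \<Rightarrow>\<^sub>L 'a"
      by (intro bounded_bilinear.continuous_on[OF bounded_bilinear_blinfun_compose]
          continuous_on_id continuous_on_const continuous_on_adj)+
    ultimately show "closed A"
      by (metis (no_types, lifting) closed_BH closed_INT closed_Int S(2) continuous_closed_preimage)
  next
    fix a b assume ab: "a \<in> A" "b \<in> A"
    then have "adj (a o\<^sub>L b) = adj b o\<^sub>L adj a" by (simp add: A_def adj_compose)
    moreover have "(u o\<^sub>L v) o\<^sub>L t = u o\<^sub>L (v o\<^sub>L t)" for u v t :: "'a \<Rightarrow>\<^sub>L 'a"
      by (rule blinfun_eqI) simp
    ultimately show "a o\<^sub>L b \<in> A" using ab by (simp add: A_def BH_compose)
  next
    fix a assume "a \<in> A"
    then show "adj a \<in> A" by (simp add: A_def adj_in_BH adj_adj)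
  qed
  moreover have "X \<subseteq> A" using XB X by (auto simp: A_def)
  ultimately have "c \<in> A" using c cstar_generated_least by blast
  then show ?thesis using s by (simp add: A_def)
qed

text \<open>On words in \<open>X\<close> and \<open>X\<^sup>*\<close> both maps are products of the letters for the Choi--Effros
  multiplication on their common range, which by \<open>ucp_product_unique\<close> is the same for both. In terms of single letters: the set
  where they agree contains the unit and is stable under left multiplication by elements of the range.\<close>

lemma ucp_agree_on_generated:
  assumes XB: "X \<subseteq> BH" and \<phi>: "ucp \<phi>" and \<gamma>: "ucp \<gamma>"
    and fix_X: "\<And>x. x \<in> X \<Longrightarrow> \<phi> x = x"
    and \<phi>\<phi>: "\<And>a. a \<in> BH \<Longrightarrow> \<phi> (\<phi> a) = \<phi> a" and \<gamma>\<gamma>: "\<And>a. a \<in> BH \<Longrightarrow> \<gamma> (\<gamma> a) = \<gamma> a"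
    and \<phi>\<gamma>: "\<And>a. a \<in> BH \<Longrightarrow> \<phi> (\<gamma> a) = \<gamma> a" and \<gamma>\<phi>: "\<And>a. a \<in> BH \<Longrightarrow> \<gamma> (\<phi> a) = \<phi> a"
    and c: "c \<in> cstar_generated X"
  shows "\<phi> c = \<gamma> c"
proof -
  define S where "S = {s \<in> BH. \<phi> s = \<gamma> s}"
  have sub: "complex_vector.subspace S"
    by (rule complex_vector.subspaceI)
      (auto simp: S_def BH_zero BH_add BH_scale ucp_zero ucp_add[OF \<phi>] ucp_add[OF \<gamma>]
        ucp_scale[OF \<phi>] ucp_scale[OF \<gamma>] \<phi> \<gamma>)
  have "S = BH \<inter> (\<lambda>s. \<phi> s - \<gamma> s) -` {0}" by (auto simp: S_def)
  moreover have "continuous_on BH (\<lambda>s. \<phi> s - \<gamma> s)"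
    by (intro continuous_on_diff continuous_on_ucp \<phi> \<gamma>)
  ultimately have cl: "closed S"
    using continuous_closed_preimage[OF _ closed_BH, of "\<lambda>s. \<phi> s - \<gamma> s" "{0}"] by simp
  have step: "x o\<^sub>L s \<in> S" if x: "x \<in> BH" "\<phi> x = x" and s: "s \<in> S" for x s
  proof -
    have sB: "s \<in> BH" and eq: "\<gamma> s = \<phi> s" using s by (auto simp: S_def)
    have \<gamma>x: "\<gamma> x = x" using \<gamma>\<phi>[OF x(1)] by (simp add: x(2))
    have "\<phi> (x o\<^sub>L s) = \<phi> (x o\<^sub>L \<phi> s)" by (rule ucp_module[OF \<phi> \<phi>\<phi> x sB])
    also have "\<dots> = \<gamma> (x o\<^sub>L \<phi> s)"
      using x sB by (intro ucp_product_unique[OF \<phi> \<gamma> \<phi>\<gamma> \<gamma>\<phi>]) (auto simp: \<phi>\<phi> ucp_BH[OF \<phi>])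
    also have "\<dots> = \<gamma> (x o\<^sub>L s)" using ucp_module[OF \<gamma> \<gamma>\<gamma> x(1) \<gamma>x sB] by (simp add: eq)
    finally show ?thesis using x(1) sB by (simp add: S_def BH_compose)
  qed
  have "c o\<^sub>L id_blinfun \<in> S"
  proof (rule cstar_generated_stabiliser[OF XB sub cl _ c])
    show "id_blinfun \<in> S" by (simp add: S_def BH_id ucp_unit \<phi> \<gamma>)
    fix x s assume x: "x \<in> X" and s: "s \<in> S"
    have "x \<in> BH" using x XB by blast
    then show "x o\<^sub>L s \<in> S \<and> adj x o\<^sub>L s \<in> S"
      using s by (intro conjI step) (auto simp: fix_X x adj_in_BH ucp_adj[OF \<phi>])
  qed
  moreover have "c o\<^sub>L id_blinfun = c" by (rule blinfun_eqI) simp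
  ultimately show ?thesis by (simp add: S_def)
qed

theorem corollary3p1:
  fixes X I :: "('a::chilbert_space \<Rightarrow>\<^sub>L 'a) set"
  assumes "unital_operator_space X"
    and "maximal_boundary_subsystem X I"
  shows "is_shilov_ideal X (cstar_generated X) (I \<inter> cstar_generated X)"
proof -
  note X = assms(1) and max = assms(2)
  define C where "C = cstar_generated X"
  have XB: "X \<subseteq> BH" and Xs: "complex_vector.subspace X" "id_blinfun \<in> X"
    using X by (auto simp: unital_operator_space_def)
  have IB: "I \<subseteq> BH" and Is: "complex_vector.subspace I" and Iadj: "\<And>y. y \<in> I \<Longrightarrow> adj y \<in> I"
    and Ib: "accretive_boundary X I"
    using max by (auto simp: maximal_boundary_subsystem_def boundary_subsystem_iff[OF X])
  have C: "C \<subseteq> BH" "complex_vector.subspace C" "closed C"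
    "\<And>a b. a \<in> C \<Longrightarrow> b \<in> C \<Longrightarrow> a o\<^sub>L b \<in> C" "\<And>a. a \<in> C \<Longrightarrow> adj a \<in> C"
    using cstar_subalgebra_generated[OF XB] by (auto simp: C_def cstar_subalgebra_def)
  obtain \<phi> where \<phi>: "ucp \<phi>" "\<And>x. x \<in> X \<Longrightarrow> \<phi> x = x" "\<And>y. y \<in> I \<Longrightarrow> \<phi> y = 0"
    using ucp_extension[OF X Is IB Ib] by blast
  have I_ker: "I = {a \<in> BH. \<phi> a = 0}" by (rule maximal_boundary_ucp(1)[OF X max \<phi>])
  have idem: "\<phi> (\<phi> a) = \<phi> a" if "a \<in> BH" for a by (rule maximal_boundary_ucp(2)[OF X max \<phi> that])
  have "I = BH \<inter> \<phi> -` {0}" by (auto simp: I_ker)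
  then have I_closed: "closed I"
    using continuous_closed_preimage[OF continuous_on_ucp[OF \<phi>(1)] closed_BH, of "{0}"] by simp
  have left: "c o\<^sub>L y \<in> I" if "c \<in> C" "y \<in> I" for c y
  proof (rule cstar_generated_stabiliser[OF XB Is I_closed _ that[unfolded C_def]])
    fix x y assume x: "x \<in> X" and y: "y \<in> I"
    have "x \<in> BH" using x XB by blast
    then show "x o\<^sub>L y \<in> I \<and> adj x o\<^sub>L y \<in> I"
      using y by (auto simp: I_ker BH_compose adj_in_BH \<phi>(2)[OF x] ucp_adj[OF \<phi>(1)]
          intro!: ucp_kernel_module[OF \<phi>(1) idem])
  qed
  have right: "y o\<^sub>L c \<in> I" if "c \<in> C" "y \<in> I" for c y
  proof -
    have cy: "c \<in> BH" "y \<in> BH" using that C(1) IB by auto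
    have "adj (adj c o\<^sub>L adj y) \<in> I" using that by (intro Iadj left C(5))
    then show ?thesis using cy by (simp add: adj_compose adj_in_BH adj_adj)
  qed
  have sub: "complex_vector.subspace (I \<inter> C)" by (rule complex_vector.subspace_inter[OF Is C(2)])
  have "closed_ideal C (I \<inter> C)"
    unfolding closed_ideal_def
    by (auto simp: sub intro: closed_Int I_closed C(3) left right C(4))
  moreover have "accretive_boundary X (I \<inter> C)" using Ib unfolding accretive_boundary_def by (meson IntD1)
  ultimately have "boundary_ideal X C (I \<inter> C)"
    unfolding boundary_ideal_def by (simp add: completely_isometric_iff_accretive_boundary[OF Xs sub])
  moreover have "J \<subseteq> I \<inter> C" if J: "boundary_ideal X C J" for J
  proof -
    have JC: "J \<subseteq> C" and Js: "complex_vector.subspace J"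
      using J by (auto simp: boundary_ideal_def closed_ideal_def)
    have Jb: "accretive_boundary X J"
      using J by (simp add: boundary_ideal_def completely_isometric_iff_accretive_boundary[OF Xs Js])
    have JB: "J \<subseteq> BH" using JC C(1) by blast
    \<comment> \<open>The map \<open>\<phi> \<psi> \<phi>\<close> fixes \<open>X\<close> and kills \<open>I\<close>, so it is idempotent with the same kernel as \<open>\<phi>\<close>; as
      its range lies in that of \<open>\<phi>\<close>, it is \<open>\<phi>\<close>. Hence \<open>\<phi> \<psi>\<close> is a second projection onto
      the range of \<open>\<phi>\<close>, and it kills \<open>J\<close>.\<close>
    obtain \<psi> where \<psi>: "ucp \<psi>" "\<And>x. x \<in> X \<Longrightarrow> \<psi> x = x" "\<And>y. y \<in> J \<Longrightarrow> \<psi> y = 0"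
      using ucp_extension[OF X Js JB Jb] by blast
    note cl = ucp_BH[OF \<phi>(1)] ucp_BH[OF \<psi>(1)]
    define \<gamma> where "\<gamma> a = \<phi> (\<psi> a)" for a
    have \<gamma>: "ucp \<gamma>" unfolding \<gamma>_def[abs_def] by (rule ucp_compose[OF \<phi>(1) \<psi>(1)])
    define \<theta> where "\<theta> a = \<gamma> (\<phi> a)" for a
    have \<theta>: "ucp \<theta>" unfolding \<theta>_def[abs_def] by (rule ucp_compose[OF \<gamma> \<phi>(1)])
    have \<theta>X: "\<theta> x = x" if "x \<in> X" for x using that by (simp add: \<theta>_def \<gamma>_def \<phi> \<psi>)
    have \<theta>I: "\<theta> y = 0" if "y \<in> I" for y
      using that by (simp add: \<theta>_def \<phi>(3) ucp_zero[OF \<gamma>])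
    have \<theta>_ker: "I = {a \<in> BH. \<theta> a = 0}" and \<theta>\<theta>: "\<theta> (\<theta> a) = \<theta> a" if "a \<in> BH" for a
      using maximal_boundary_ucp[OF X max \<theta> \<theta>X \<theta>I] that by auto
    have \<theta>_eq: "\<theta> a = \<phi> a" if a: "a \<in> BH" for a
    proof -
      have "a - \<theta> a \<in> I"
        using a by (simp add: \<theta>_ker[OF a] BH_diff ucp_BH[OF \<theta>] ucp_diff[OF \<theta>] \<theta>\<theta>)
      then have "\<phi> a = \<phi> (\<theta> a)" using \<phi>(3) a by (fastforce simp: ucp_diff[OF \<phi>(1)] ucp_BH[OF \<theta>])
      also have "\<dots> = \<theta> a" using a by (simp add: \<theta>_def \<gamma>_def idem cl)
      finally show ?thesis by simp
    qed
    have \<gamma>\<phi>: "\<gamma> (\<phi> a) = \<phi> a" if "a \<in> BH" for a using \<theta>_eq[OF that] by (simp add: \<theta>_def)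
    have \<phi>\<gamma>: "\<phi> (\<gamma> a) = \<gamma> a" if "a \<in> BH" for a using that by (simp add: \<gamma>_def idem cl)
    have \<gamma>\<gamma>: "\<gamma> (\<gamma> a) = \<gamma> a" if "a \<in> BH" for a
      using \<gamma>\<phi>[of "\<psi> a"] that by (simp add: \<gamma>_def cl)
    show ?thesis
    proof
      fix y assume y: "y \<in> J"
      then have "\<phi> y = \<gamma> y"
        using JC by (intro ucp_agree_on_generated[OF XB \<phi>(1) \<gamma> \<phi>(2) idem \<gamma>\<gamma> \<phi>\<gamma> \<gamma>\<phi>])
          (auto simp: C_def)
      also have "\<dots> = 0" by (simp add: \<gamma>_def \<psi>(3)[OF y] ucp_zero[OF \<phi>(1)])
      finally show "y \<in> I \<inter> C" using y JB JC by (auto simp: I_ker)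
    qed
  qed
  ultimately show ?thesis unfolding is_shilov_ideal_def C_def by blast
qed

end
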